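(* Let $\mathcal{H}(T,A,\mu)$ be a Cauchy--de Branges space of the convergence class and of finite order, and for $\gamma\in\mathbb{C}$ let $$B_\gamma(z)=A(z)\Big(\gamma+\sum_n\frac{\mu_n}{t_n-z}\Big).$$ 1. For every $\gamma\ne0$ the zero set $\mathcal{Z}(B_\gamma)$ (counting multiplicities) is a uniqueness set for $\mathcal{H}(T,A,\mu)$, i.e. the only $F\in\mathcal{H}(T,A,\mu)$ vanishing on $\mathcal{Z}(B_\gamma)$ with at least the corresponding multiplicities is $F\equiv0$. 2. If moreover the space is small, then $\mathcal{Z}(B_0)$ is not a uniqueness set for $\mathcal{H}(T,A,\mu)$, but the subspace of functions in $\mathcal{H}(T,A,\mu)$ vanishing on $\mathcal{Z}(B_0)$ (counting multiplicities) is one-dimensional.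
   Context: Let $T=\{t_n\}_{n\ge1}\subset\mathbb{C}$ be a set of distinct points with $|t_n|\to\infty$, and let $\mu_n>0$ satisfy $\sum_n\frac{\mu_n}{|t_n|^2+1}<\infty$; write $\mu=\sum_n\mu_n\delta_{t_n}$. Let $A$ be an entire function with simple zeros exactly at the points of $T$ and no other zeros. The Cauchy--de Branges space is $\mathcal{H}(T,A,\mu)=\{F(z)=A(z)\sum_n\frac{c_n\mu_n^{1/2}}{z-t_n}:(c_n)\in\ell^2\}$ with norm $\|F\|=\|(c_n)\|_{\ell^2}$; it is a reproducing kernel Hilbert space of entire functions. It is of the convergence class if $\sum_n\frac{\mu_n}{|t_n|+1}<\infty$, and small if $\sum_n\mu_n<\infty$. It is of finite order if all its elements are entire functions of finite order (equivalently, $A$ has finite order). *)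

theory Defs
  imports "HOL-Analysis.Analysis"
begin

text \<open>The entire function z \<mapsto> A z / (z - t n), extended at z = t n by its limit
  deriv A (t n) (A has a simple zero at t n).\<close>
definition cdb_kernel :: "(complex \<Rightarrow> complex) \<Rightarrow> (nat \<Rightarrow> complex) \<Rightarrow> nat \<Rightarrow> complex \<Rightarrow> complex" where
  "cdb_kernel A t n z = (if z = t n then deriv A (t n) else A z / (z - t n))"

definition cdb_data :: "(nat \<Rightarrow> complex) \<Rightarrow> (nat \<Rightarrow> real) \<Rightarrow> (complex \<Rightarrow> complex) \<Rightarrow> bool" where
  "cdb_data t \<mu> A \<longleftrightarrow>
     inj t \<and> filterlim (\<lambda>n. norm (t n)) at_top sequentially \<and>
     (\<forall>n. \<mu> n > 0) \<and> summable (\<lambda>n. \<mu> n / ((norm (t n))\<^sup>2 + 1)) \<and>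
     A holomorphic_on UNIV \<and> (\<forall>z. A z = 0 \<longleftrightarrow> z \<in> range t) \<and>
     (\<forall>n. deriv A (t n) \<noteq> 0)"

definition cdb_space :: "(nat \<Rightarrow> complex) \<Rightarrow> (nat \<Rightarrow> real) \<Rightarrow> (complex \<Rightarrow> complex) \<Rightarrow> (complex \<Rightarrow> complex) set" where
  "cdb_space t \<mu> A = {F. \<exists>c :: nat \<Rightarrow> complex. summable (\<lambda>n. (norm (c n))\<^sup>2) \<and>
      F = (\<lambda>z. \<Sum>n. c n * of_real (sqrt (\<mu> n)) * cdb_kernel A t n z)}"

definition convergence_class :: "(nat \<Rightarrow> complex) \<Rightarrow> (nat \<Rightarrow> real) \<Rightarrow> bool" where
  "convergence_class t \<mu> \<longleftrightarrow> summable (\<lambda>n. \<mu> n / (norm (t n) + 1))"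

definition small_space :: "(nat \<Rightarrow> real) \<Rightarrow> bool" where
  "small_space \<mu> \<longleftrightarrow> summable \<mu>"

definition finite_order :: "(complex \<Rightarrow> complex) \<Rightarrow> bool" where
  "finite_order A \<longleftrightarrow> (\<exists>\<rho> C. \<forall>z. norm (A z) \<le> C * exp (norm z powr \<rho>))"

definition cdb_B :: "(nat \<Rightarrow> complex) \<Rightarrow> (nat \<Rightarrow> real) \<Rightarrow> (complex \<Rightarrow> complex) \<Rightarrow> complex \<Rightarrow> complex \<Rightarrow> complex" where
  "cdb_B t \<mu> A \<gamma> z = \<gamma> * A z - (\<Sum>n. of_real (\<mu> n) * cdb_kernel A t n z)"

text \<open>F vanishes on the zero set of B counting multiplicities: at every point z,
  the k-th derivative of F vanishes whenever the 0-th,...,k-th derivatives of B vanish.\<close>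
definition vanishes_on_zeros :: "(complex \<Rightarrow> complex) \<Rightarrow> (complex \<Rightarrow> complex) \<Rightarrow> bool" where
  "vanishes_on_zeros F B \<longleftrightarrow>
     (\<forall>z k. (\<forall>j\<le>k. (deriv ^^ j) B z = 0) \<longrightarrow> (deriv ^^ k) F z = 0)"

definition uniqueness_set_of :: "(complex \<Rightarrow> complex) set \<Rightarrow> (complex \<Rightarrow> complex) \<Rightarrow> bool" where
  "uniqueness_set_of H B \<longleftrightarrow> (\<forall>F\<in>H. vanishes_on_zeros F B \<longrightarrow> F = (\<lambda>z. 0))"

end

theory Submission
  imports Defs "HOL-Complex_Analysis.Complex_Analysis"
begin

text \<open>
  Let F in the space vanish on the zeros of B, the function B_\<gamma>. Then F = S B with S
  entire, and S is of finite order: Jensen's inequality for B bounds the circle means of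
  log+ |S| = max 0 (log |S|), and Harnack's inequality turns this into a pointwise bound. For \<gamma> \<noteq> 0, B / A differs from \<gamma> by at most a Cauchy potential
  W(z) = \<Sum> w_n / |z - t_n| with \<Sum> w_n / (1 + |t_n|) < \<infinity>, and F / A is bounded by W, so S is small
  wherever W is small. For \<gamma> = 0 and \<mu> finite, the same holds for S - a with a suitable constant a,
  after multiplying both F / A and B / A by z.

  On suitable circles of radius between 2R and 4R the set where W is not small has angular measure
  o(1). Hence the maximum M(R) of log+ |S| on the disc of radius R satisfies
  M(R) \<le> \<epsilon> M(4R) for every \<epsilon> > 0 and all large R; as M grows polynomially, iterating gives M = 0,
  that is |S| \<le> 1. Applied to S / \<eta> for every \<eta> > 0, this gives S = 0.
\<close>

section \<open>Circle means of the positive part of log |f|\<close>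

text \<open>The quotients F / A and B / A have poles at the points \<open>t n\<close>, and nothing
  is assumed about the separation of these points. No circle need avoid their neighbourhoods, so the
  maximum principle alone does not bound S. What survives is an average: the mean of the potential
  in r and \<theta> over the annulus of radii 2R to 4R tends to 0, hence so does its mean over some
  circle in that annulus. This is enough because log+ |S| is subharmonic: a bad set of angles
  contributes at most its measure times M(4R). The radii start at 2R so that the disc of radius R
  stays at half the radius of the circle, where Harnack's constant is 3.

  The function log |B| is never integrated. Circle integrals of continuous functions are
  approximated by sums over the vertices of a rotated regular N-gon, where a product of holomorphic
  functions and the maximum modulus principle do the work of Jensen's formula.\<close>

lemma integral_periodic:
  fixes h :: "real \<Rightarrow> real"
  assumes cont: "continuous_on UNIV h" and per: "\<And>x. h (x + 2 * pi) = h x"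
    and \<phi>: "\<bar>\<phi>\<bar> \<le> 2 * pi"
  shows "integral {\<phi>..\<phi> + 2 * pi} h = integral {0..2 * pi} h"
proof -
  have c: "continuous_on {a..b} h" for a b
    using cont continuous_on_subset by blast
  have i: "h integrable_on {a..b}" for a b
    by (rule integrable_continuous_real[OF c])
  have shift: "integral {a + 2 * pi..b + 2 * pi} h = integral {a..b} h" for a b
  proof -
    have "h \<circ> (\<lambda>x. x + 2 * pi) = h" using per by auto
    then show ?thesis using integral_shift[where f = h and c = "2 * pi" and a = a and b = b, OF c] by simp
  qed
  have pos: "integral {x..x + 2 * pi} h = integral {0..2 * pi} h" if x: "0 \<le> x" "x \<le> 2 * pi" for x
  proof -
    have "integral {x..x + 2 * pi} h = integral {x..2 * pi} h + integral {2 * pi..x + 2 * pi} h"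
      using x by (intro Henstock_Kurzweil_Integration.integral_combine[symmetric] i) auto
    also have "integral {2 * pi..x + 2 * pi} h = integral {0..x} h"
      using shift[of 0 x] by simp
    also have "integral {x..2 * pi} h + integral {0..x} h = integral {0..2 * pi} h"
      using Henstock_Kurzweil_Integration.integral_combine[OF x i] by simp
    finally show ?thesis .
  qed
  show ?thesis
  proof (cases "0 \<le> \<phi>")
    case True then show ?thesis using pos \<phi> by auto
  next
    case False
    then show ?thesis using shift[of \<phi> "\<phi> + 2 * pi"] pos[of "\<phi> + 2 * pi"] \<phi> by auto
  qed
qed

lemma abs_diff_le_add:
  fixes x y :: real
  assumes "x \<le> z" "\<bar>x - y\<bar> \<le> e"
  shows "y \<le> z + e"
  using assms by linarith

lemma integral_telescope:
  fixes h :: "real \<Rightarrow> real"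
  assumes cont: "continuous_on UNIV h" and d: "d \<ge> 0"
  shows "integral {a..a + real N * d} h = (\<Sum>k<N. integral {a + real k * d..a + real (Suc k) * d} h)"
proof (induction N)
  case (Suc N)
  have i: "h integrable_on {a..b}" for a b
    using cont continuous_on_subset by (blast intro: integrable_continuous_real)
  have "integral {a..a + real (Suc N) * d} h
      = integral {a..a + real N * d} h + integral {a + real N * d..a + real (Suc N) * d} h"
    using d by (intro Henstock_Kurzweil_Integration.integral_combine[symmetric] i) 
      (auto intro!: mult_right_mono)
  then show ?case using Suc by simp
qed simp

text \<open>The point is that \<open>N\<close> does not depend on the shift \<phi>, which is later
  chosen as a function of \<open>N\<close>. Uniform continuity on \<open>{0..4 * pi}\<close> gives
  this, because all shifted periods lie in that interval.\<close>

lemma circle_average_approx: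
  fixes h :: "real \<Rightarrow> real"
  assumes cont: "continuous_on UNIV h" and per: "\<And>x. h (x + 2 * pi) = h x" and e: "e > 0"
  obtains N :: nat where "N > 0"
    "\<And>\<phi>. 0 \<le> \<phi> \<Longrightarrow> \<phi> \<le> 2 * pi \<Longrightarrow>
       \<bar>(\<Sum>k<N. h (\<phi> + real k * (2 * pi / real N))) * (2 * pi / real N) - integral {0..2 * pi} h\<bar> \<le> e"
proof -
  have c: "continuous_on {a..b} h" for a b
    using cont continuous_on_subset by blast
  have i: "h integrable_on {a..b}" for a b
    by (rule integrable_continuous_real[OF c])
  have "uniformly_continuous_on {0..4 * pi} h"
    by (rule compact_uniformly_continuous[OF c]) simp
  then obtain \<delta> where \<delta>: "\<delta> > 0"
    "\<And>x y. x \<in> {0..4 * pi} \<Longrightarrow> y \<in> {0..4 * pi} \<Longrightarrow> dist y x < \<delta> \<Longrightarrow> dist (h y) (h x) < e / (2 * pi)"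
    unfolding uniformly_continuous_on_def using e by (metis divide_pos_pos pi_gt_zero zero_less_mult_iff zero_less_numeral)
  obtain N :: nat where N: "real N > 2 * pi / \<delta>" using reals_Archimedean2 by blast
  define d where "d = 2 * pi / real N"
  have N0: "N > 0" using N \<delta> by (metis divide_pos_pos gr0I less_trans not_less_iff_gr_or_eq of_nat_0 pi_gt_zero zero_less_mult_iff zero_less_numeral)
  have d: "0 < d" "d < \<delta>" "real N * d = 2 * pi"
    using N N0 \<delta> by (auto simp: d_def field_simps)
  show ?thesis
  proof (rule that[OF N0])
    fix \<phi> :: real assume \<phi>: "0 \<le> \<phi>" "\<phi> \<le> 2 * pi"
    have piece: "\<bar>h (\<phi> + real k * d) * d - integral {\<phi> + real k * d..\<phi> + real (Suc k) * d} h\<bar> \<le> e / (2 * pi) * d"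
      if k: "k < N" for k
    proof -
      let ?a = "\<phi> + real k * d"
      have b: "\<phi> + real (Suc k) * d = ?a + d" by (simp add: algebra_simps)
      have "real (Suc k) * d \<le> real N * d" using k d by (intro mult_right_mono) auto
      then have top: "?a + d \<le> 4 * pi" using \<phi> d b by auto
      have a0: "0 \<le> ?a" using \<phi> d by auto
      have I: "((\<lambda>x. h ?a - h x) has_integral (h ?a * d - integral {?a..?a + d} h)) {?a..?a + d}"
        using has_integral_diff[OF has_integral_const_real[of "h ?a" ?a "?a + d"] integrable_integral[OF i[of ?a "?a + d"]]]
          d by (simp add: mult.commute)
      have "norm (h ?a * d - integral {?a..?a + d} h) \<le> e / (2 * pi) * measure lborel (cbox ?a (?a + d))"
      proof (rule has_integral_bound[of "e / (2 * pi)" "\<lambda>x. h ?a - h x"])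
        show "0 \<le> e / (2 * pi)" using e by simp
        show "((\<lambda>x. h ?a - h x) has_integral (h ?a * d - integral {?a..?a + d} h)) (cbox ?a (?a + d))"
          using I by (simp add: box_real)
        fix x assume "x \<in> cbox ?a (?a + d)"
        then show "norm (h ?a - h x) \<le> e / (2 * pi)"
          using \<delta>(2)[of x ?a] d top a0 by (auto simp: dist_real_def)
      qed
      then show ?thesis unfolding b using d by simp
    qed
    have "\<bar>(\<Sum>k<N. h (\<phi> + real k * d)) * d - integral {\<phi>..\<phi> + real N * d} h\<bar>
        = \<bar>\<Sum>k<N. h (\<phi> + real k * d) * d - integral {\<phi> + real k * d..\<phi> + real (Suc k) * d} h\<bar>"
      using d by (subst integral_telescope[OF cont]) (auto simp: sum_distrib_right sum_subtractf)
    also have "\<dots> \<le> (\<Sum>k<N. e / (2 * pi) * d)"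
      by (rule order_trans[OF sum_abs sum_mono]) (use piece in auto)
    also have "\<dots> = real N * d * (e / (2 * pi))" by simp
    also have "\<dots> = e" unfolding d(3) by simp
    also have "integral {\<phi>..\<phi> + real N * d} h = integral {0..2 * pi} h"
      unfolding d(3) by (rule integral_periodic[OF cont per]) (use \<phi> in auto)
    finally show "\<bar>(\<Sum>k<N. h (\<phi> + real k * (2 * pi / real N))) * (2 * pi / real N) - integral {0..2 * pi} h\<bar> \<le> e"
      unfolding d_def .
  qed
qed

text \<open>The product of the N rotated copies of \<open>g\<close> is holomorphic with value
  \<open>g 0 ^ N\<close> at the centre, so the maximum modulus principle finds a point of the unit
  circle where it is at least as large. After taking logarithms this is a discrete mean value
  inequality for log |g|, valid even if \<open>g\<close> has zeros on the circle.\<close>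

lemma max_modulus_rotated_prod:
  fixes g :: "complex \<Rightarrow> complex"
  assumes g: "g holomorphic_on ball 0 \<rho>" and \<rho>: "\<rho> > 1"
  obtains \<phi> where "0 \<le> \<phi>" "\<phi> \<le> 2 * pi"
    "norm (g 0) ^ N \<le> (\<Prod>k<N. norm (g (cis (\<phi> + real k * (2 * pi / real N)))))"
proof -
  let ?d = "2 * pi / real N"
  define H where "H = (\<lambda>w. \<Prod>k<N. g (cis (real k * ?d) * w))"
  have sub: "(\<lambda>w. cis x * w) ` ball 0 \<rho> \<subseteq> ball 0 \<rho>" for x
    by (auto simp: norm_mult)
  have holH: "H holomorphic_on ball 0 \<rho>"
    unfolding H_def
    by (intro holomorphic_on_prod) (use holomorphic_on_compose_gen[OF _ g sub, unfolded o_def] in \<open>auto intro: holomorphic_intros\<close>)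
  have cb: "cball 0 1 \<subseteq> ball (0::complex) \<rho>" using \<rho> by auto
  have contH: "continuous_on (cball 0 1) H"
    by (rule continuous_on_subset[OF holomorphic_on_imp_continuous_on[OF holH] cb])
  have "\<exists>x\<in>sphere (0::complex) 1. \<forall>y\<in>sphere 0 1. norm (H y) \<le> norm (H x)"
  proof (rule continuous_attains_sup)
    show "compact (sphere (0::complex) 1)" by simp
    have "1 \<in> sphere (0::complex) 1" by simp
    then show "sphere (0::complex) 1 \<noteq> {}" by blast
    show "continuous_on (sphere 0 1) (\<lambda>y. norm (H y))"
      by (intro continuous_intros continuous_on_subset[OF contH]) auto
  qed
  then obtain x where x: "x \<in> sphere 0 1" "\<And>y. y \<in> sphere 0 1 \<Longrightarrow> norm (H y) \<le> norm (H x)" by blast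
  have "norm (H 0) \<le> norm (H x)"
  proof (rule maximum_modulus_frontier[of H "cball 0 1"])
    show "H holomorphic_on interior (cball 0 1)"
      using holH by (rule holomorphic_on_subset) (use \<rho> in auto)
    show "continuous_on (closure (cball 0 1)) H" using contH by simp
  qed (use x in auto)
  moreover have "H 0 = g 0 ^ N" by (simp add: H_def)
  moreover have "x = cis (Arg2pi x)"
    using x(1) Arg2pi_eq[of x] by (simp add: cis_conv_exp)
  then have "H x = (\<Prod>k<N. g (cis (Arg2pi x + real k * ?d)))"
    unfolding H_def by (metis (no_types, lifting) add.commute cis_mult)
  ultimately show ?thesis
    using that[of "Arg2pi x"] Arg2pi_ge_0[of x] Arg2pi_lt_2pi[of x]
    by (simp add: norm_power prod_norm)
qed

text \<open>Subharmonicity of log+ |g| at the centre. If \<open>norm (g 0) > 1\<close>, raising each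
  factor of the rotated product to at least 1 turns its logarithm into a sum of values of log+ |g|,
  which approximates the integral; otherwise the left side is 0.\<close>

lemma ln_max_mean_le:
  fixes g :: "complex \<Rightarrow> complex"
  assumes g: "g holomorphic_on ball 0 \<rho>" and \<rho>: "\<rho> > 1"
  shows "2 * pi * ln (max 1 (norm (g 0))) \<le> integral {0..2 * pi} (\<lambda>\<theta>. ln (max 1 (norm (g (cis \<theta>)))))"
proof -
  define h where "h = (\<lambda>\<theta>. ln (max 1 (norm (g (cis \<theta>)))))"
  have cg: "continuous_on UNIV (\<lambda>\<theta>. g (cis \<theta>))"
    by (rule continuous_on_compose2[OF holomorphic_on_imp_continuous_on[OF g]])
       (use \<rho> in \<open>auto intro: continuous_intros\<close>)
  have ch: "continuous_on UNIV h"
    unfolding h_def by (intro continuous_intros cg) auto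
  have per: "h (x + 2 * pi) = h x" for x by (simp add: h_def cis_mult[symmetric])
  have h0: "h x \<ge> 0" for x by (simp add: h_def)
  show ?thesis unfolding h_def[symmetric]
  proof (cases "norm (g 0) \<le> 1")
    case True
    have "0 \<le> integral {0..2 * pi} h" by (rule integral_nonneg) 
       (use h0 in \<open>auto intro: integrable_continuous_real continuous_on_subset[OF ch]\<close>)
    then show "2 * pi * ln (max 1 (norm (g 0))) \<le> integral {0..2 * pi} h" using True by simp
  next
    case False
    show "2 * pi * ln (max 1 (norm (g 0))) \<le> integral {0..2 * pi} h"
    proof (rule field_le_epsilon)
      fix e :: real assume "e > 0"
      then obtain N where N: "N > 0" "\<And>\<phi>. 0 \<le> \<phi> \<Longrightarrow> \<phi> \<le> 2 * pi \<Longrightarrow>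
       \<bar>(\<Sum>k<N. h (\<phi> + real k * (2 * pi / real N))) * (2 * pi / real N) - integral {0..2 * pi} h\<bar> \<le> e"
        using circle_average_approx[OF ch per] by blast
      obtain \<phi> where \<phi>: "0 \<le> \<phi>" "\<phi> \<le> 2 * pi"
       "norm (g 0) ^ N \<le> (\<Prod>k<N. norm (g (cis (\<phi> + real k * (2 * pi / real N)))))"
        using max_modulus_rotated_prod[OF g \<rho>] by blast
      have "norm (g 0) ^ N \<le> (\<Prod>k<N. max 1 (norm (g (cis (\<phi> + real k * (2 * pi / real N))))))"
        by (rule order_trans[OF \<phi>(3)]) (rule prod_mono, auto)
      then have "ln (norm (g 0) ^ N) \<le> ln (\<Prod>k<N. max 1 (norm (g (cis (\<phi> + real k * (2 * pi / real N))))))"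
        using False by (intro ln_mono zero_less_power) auto
      also have "\<dots> = (\<Sum>k<N. h (\<phi> + real k * (2 * pi / real N)))"
        unfolding h_def by (rule ln_prod) auto
      finally have "real N * ln (norm (g 0)) \<le> (\<Sum>k<N. h (\<phi> + real k * (2 * pi / real N)))"
        using False by (simp add: ln_realpow)
      then have "real N * ln (norm (g 0)) * (2 * pi / real N) \<le> (\<Sum>k<N. h (\<phi> + real k * (2 * pi / real N))) * (2 * pi / real N)"
        by (rule mult_right_mono) auto
      then show "2 * pi * ln (max 1 (norm (g 0))) \<le> integral {0..2 * pi} h + e"
        using N(2)[OF \<phi>(1,2)] N(1) False by (simp add: mult_ac)
    qed
  qed
qed

text \<open>The rotation angle is the one that maximises the product of the values of B; none of these
  values is 0, so the singularities of ln |B| on the circle never enter.\<close>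

lemma quotient_ln_max_mean_le:
  fixes F B S :: "complex \<Rightarrow> complex"
  assumes B: "B holomorphic_on ball 0 \<rho>" and S: "S holomorphic_on ball 0 \<rho>" and \<rho>: "\<rho> > 1"
    and eq: "\<And>w. norm w = 1 \<Longrightarrow> S w * B w = F w"
    and FK: "\<And>w. norm w = 1 \<Longrightarrow> norm (F w) \<le> exp K"
    and BK: "\<And>w. norm w = 1 \<Longrightarrow> norm (B w) \<le> exp K"
    and B0: "B 0 \<noteq> 0"
  shows "integral {0..2 * pi} (\<lambda>\<theta>. ln (max 1 (norm (S (cis \<theta>))))) \<le> 2 * pi * (K - ln (norm (B 0)))"
proof -
  define h where "h = (\<lambda>\<theta>. ln (max 1 (norm (S (cis \<theta>)))))"
  have cg: "continuous_on UNIV (\<lambda>\<theta>. S (cis \<theta>))"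
    by (rule continuous_on_compose2[OF holomorphic_on_imp_continuous_on[OF S]])
       (use \<rho> in \<open>auto intro: continuous_intros\<close>)
  have ch: "continuous_on UNIV h"
    unfolding h_def by (intro continuous_intros cg) auto
  have per: "h (x + 2 * pi) = h x" for x by (simp add: h_def cis_mult[symmetric])
  have "integral {0..2 * pi} h \<le> 2 * pi * (K - ln (norm (B 0)))"
  proof (rule field_le_epsilon)
    fix e :: real assume "e > 0"
    then obtain N where N: "N > 0" "\<And>\<phi>. 0 \<le> \<phi> \<Longrightarrow> \<phi> \<le> 2 * pi \<Longrightarrow>
       \<bar>(\<Sum>k<N. h (\<phi> + real k * (2 * pi / real N))) * (2 * pi / real N) - integral {0..2 * pi} h\<bar> \<le> e"
      using circle_average_approx[OF ch per] by blast
    obtain \<phi> where \<phi>: "0 \<le> \<phi>" "\<phi> \<le> 2 * pi"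
       "norm (B 0) ^ N \<le> (\<Prod>k<N. norm (B (cis (\<phi> + real k * (2 * pi / real N)))))"
      using max_modulus_rotated_prod[OF B \<rho>] by blast
    define x where "x = (\<lambda>k. \<phi> + real k * (2 * pi / real N))"
    have P0: "0 < norm (B 0) ^ N" using B0 by simp
    then have "0 < (\<Prod>k<N. norm (B (cis (x k))))"
      using \<phi>(3) unfolding x_def by linarith
    then have "(\<Prod>k<N. norm (B (cis (x k)))) \<noteq> 0" by linarith
    then have Bx: "norm (B (cis (x k))) > 0" if "k < N" for k
      using that by auto
    have "ln (norm (B 0) ^ N) \<le> ln (\<Prod>k<N. norm (B (cis (x k))))"
      using \<phi>(3) P0 by (intro ln_mono) (auto simp: x_def)
    also have "\<dots> = (\<Sum>k<N. ln (norm (B (cis (x k)))))"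
      by (rule ln_prod) (use Bx in auto)
    finally have lnB: "real N * ln (norm (B 0)) \<le> (\<Sum>k<N. ln (norm (B (cis (x k)))))"
      using B0 by (simp add: ln_realpow)
    have hx: "h (x k) \<le> K - ln (norm (B (cis (x k))))" if k: "k < N" for k
    proof -
      have "norm (S (cis (x k))) * norm (B (cis (x k))) \<le> exp K"
        using FK[of "cis (x k)"] eq[of "cis (x k)"] by (simp add: norm_mult[symmetric])
      \<comment> \<open>The bound on \<open>B\<close> enters here: it makes the right side at least
        1, so the maximum with 1 costs nothing.\<close>
      then have "max 1 (norm (S (cis (x k)))) \<le> exp K / norm (B (cis (x k)))"
        using Bx[OF k] BK[of "cis (x k)"] by (simp add: field_simps)
      then have "h (x k) \<le> ln (exp K / norm (B (cis (x k))))"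
        unfolding h_def by (intro ln_mono) auto
      also have "\<dots> = K - ln (norm (B (cis (x k))))"
        using Bx[OF k] by (simp add: ln_div)
      finally show ?thesis .
    qed
    have "(\<Sum>k<N. h (x k)) \<le> (\<Sum>k<N. K - ln (norm (B (cis (x k)))))"
      by (rule sum_mono) (use hx in auto)
    also have "\<dots> \<le> real N * (K - ln (norm (B 0)))"
      using lnB by (simp add: sum_subtractf algebra_simps)
    finally have "(\<Sum>k<N. h (x k)) * (2 * pi / real N) \<le> real N * (K - ln (norm (B 0))) * (2 * pi / real N)"
      by (rule mult_right_mono) auto
    also have "\<dots> = 2 * pi * (K - ln (norm (B 0)))" using N(1) by simp
    finally show "integral {0..2 * pi} h \<le> 2 * pi * (K - ln (norm (B 0))) + e"
      by (intro abs_diff_le_add) (use N(2)[OF \<phi>(1,2)] in \<open>auto simp only: x_def\<close>)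
  qed
  then show ?thesis by (simp add: h_def)
qed

text \<open>With q = \<open>1 + cnj a * cis \<theta>\<close> the numerator is
  \<open>cis \<theta> * cnj q\<close>, so the image has angle \<theta> minus twice the argument of
  q; as Re q > 0, the principal logarithm gives this argument smoothly. The derivative of the angle
  equals (1 - |a|^2) / |q|^2, the Poisson kernel at \<open>- a\<close>. For |a| \<le> 1/2 it is at
  least (3/4) / (9/4) = 1/3, which is the origin of Harnack's constant 3.\<close>

lemma moebius_on_circle:
  fixes a :: complex
  assumes a: "norm a \<le> 1/2"
  defines "\<psi> \<equiv> \<lambda>\<theta>. \<theta> - 2 * Im (Ln (1 + cnj a * cis \<theta>))"
  shows "(cis \<theta> + a) / (1 + cnj a * cis \<theta>) = cis (\<psi> \<theta>)"
    and "(\<psi> has_real_derivative Re ((1 - cnj a * cis \<theta>) / (1 + cnj a * cis \<theta>))) (at \<theta> within X)"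
    and "Re ((1 - cnj a * cis \<theta>) / (1 + cnj a * cis \<theta>)) \<ge> 1/3"
proof -
  define x where "x = cnj a * cis \<theta>"
  define q where "q = 1 + x"
  have x: "norm x \<le> 1/2" using a by (simp add: x_def norm_mult)
  have "\<bar>Re x\<bar> \<le> 1/2" using x abs_Re_le_cmod[of x] by linarith
  then have Req: "Re q > 0" by (simp add: q_def)
  then have q0: "q \<noteq> 0" by auto
  have nq: "q = of_real (norm q) * cis (Im (Ln q))"
    using exp_Ln[OF q0] Re_Ln[OF q0] q0 by (metis cis_conv_exp complex_is_Real_iff exp_ln norm_exp_eq_Re exp_eq_polar)
  then have cq: "cnj q = of_real (norm q) * cis (- Im (Ln q))"
    by (metis cis_cnj complex_cnj_complex_of_real complex_cnj_mult)
  have cx: "cis \<theta> * cnj q = cis \<theta> + a"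
  proof -
    have "cis \<theta> * cnj x = a * (cis \<theta> * cnj (cis \<theta>))" by (simp add: x_def)
    also have "cis \<theta> * cnj (cis \<theta>) = 1" by (simp add: cis_cnj cis_mult)
    finally show ?thesis by (simp add: q_def algebra_simps)
  qed
  have nq0: "complex_of_real (norm q) \<noteq> 0" using q0 by simp
  have "(cis \<theta> + a) / q = cis \<theta> * (of_real (norm q) * cis (- Im (Ln q))) / (of_real (norm q) * cis (Im (Ln q)))"
    using cx cq nq by metis
  also have "\<dots> = cis \<theta> * (cis (- Im (Ln q)) / cis (Im (Ln q)))"
    using nq0 by simp
  also have "\<dots> = cis (\<theta> - 2 * Im (Ln q))"
    by (simp add: cis_divide cis_mult algebra_simps)
  finally show "(cis \<theta> + a) / (1 + cnj a * cis \<theta>) = cis (\<psi> \<theta>)"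
    by (simp add: \<psi>_def q_def x_def)
  have qn: "1 + cnj a * cis \<theta> \<notin> \<real>\<^sub>\<le>\<^sub>0"
    using Req by (auto simp: q_def x_def complex_nonpos_Reals_iff)
  have "((\<lambda>\<theta>. 1 + cnj a * cis \<theta>) has_vector_derivative (\<i> * x)) (at \<theta> within X)"
    unfolding x_def has_vector_derivative_def
    by (auto intro!: derivative_eq_intros simp: fun_eq_iff scaleR_conv_of_real algebra_simps)
  then have "(Ln \<circ> (\<lambda>\<theta>. 1 + cnj a * cis \<theta>) has_vector_derivative (\<i> * x) * inverse q) (at \<theta> within X)"
    by (rule field_vector_diff_chain_within)
       (use has_field_derivative_Ln[OF qn] in \<open>auto simp: q_def x_def has_field_derivative_at_within\<close>)
  then have "((\<lambda>\<theta>. Im (Ln (1 + cnj a * cis \<theta>))) has_vector_derivative Im ((\<i> * x) * inverse q)) (at \<theta> within X)"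
    using bounded_linear.has_vector_derivative[OF bounded_linear_Im] by (force simp: o_def)
  then have "((\<lambda>\<theta>. Im (Ln (1 + cnj a * cis \<theta>))) has_real_derivative Re (x / q)) (at \<theta> within X)"
    by (simp add: has_real_derivative_iff_has_vector_derivative divide_inverse mult.assoc)
  then have "(\<psi> has_real_derivative 1 - 2 * Re (x / q)) (at \<theta> within X)"
    unfolding \<psi>_def using DERIV_diff[OF DERIV_ident DERIV_cmult] by blast
  moreover have "(1 - x) / q = 1 - (x / q + x / q)"
    using q0 by (simp add: q_def add_divide_distrib[symmetric] diff_divide_eq_iff)
  then have "Re ((1 - x) / q) = 1 - 2 * Re (x / q)"
    by (simp only: minus_complex.sel plus_complex.sel one_complex.sel mult_2)
  ultimately show "(\<psi> has_real_derivative Re ((1 - cnj a * cis \<theta>) / (1 + cnj a * cis \<theta>))) (at \<theta> within X)"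
    by (simp add: q_def x_def)
  have "Re ((1 - x) / q) = Re ((1 - x) * cnj q) / (norm q)\<^sup>2"
    by (subst complex_div_cnj) (simp only: of_real_power[symmetric] Re_divide_of_real)
  also have "Re ((1 - x) * cnj q) = 1 - (norm x)\<^sup>2"
    using cmod_power2[of x] by (simp add: q_def power2_eq_square algebra_simps)
  finally have "Re ((1 - x) / q) = (1 - (norm x)\<^sup>2) / (norm q)\<^sup>2" .
  moreover have "(norm x)\<^sup>2 \<le> (1/2)\<^sup>2" using x by (intro power_mono) auto
  moreover have "norm q \<le> 3/2" using x norm_triangle_ineq[of 1 x] by (simp add: q_def)
  then have "(norm q)\<^sup>2 \<le> (3/2)\<^sup>2" by (intro power_mono) auto
  moreover have "(norm q)\<^sup>2 > 0" using q0 by simp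
  ultimately have "Re ((1 - x) / q) \<ge> 1/3"
    by (simp add: pos_le_divide_eq power2_eq_square)
  then show "Re ((1 - cnj a * cis \<theta>) / (1 + cnj a * cis \<theta>)) \<ge> 1/3"
    by (simp add: q_def x_def)
qed

text \<open>Apply the mean value inequality to the composition of g with the disc automorphism moving 0 to a.\<close>

lemma ln_max_harnack:
  fixes g :: "complex \<Rightarrow> complex"
  assumes g: "g holomorphic_on UNIV" and a: "norm a \<le> 1/2"
  shows "2 * pi * ln (max 1 (norm (g a))) \<le> 3 * integral {0..2 * pi} (\<lambda>\<theta>. ln (max 1 (norm (g (cis \<theta>)))))"
proof -
  define h where "h = (\<lambda>\<theta>. ln (max 1 (norm (g (cis \<theta>)))))"
  have cg: "continuous_on UNIV (\<lambda>\<theta>. g (cis \<theta>))"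
    by (rule continuous_on_compose2[OF holomorphic_on_imp_continuous_on[OF g]])
       (auto intro: continuous_intros)
  have ch: "continuous_on UNIV h"
    unfolding h_def by (intro continuous_intros cg) auto
  have per: "h (x + 2 * pi) = h x" for x by (simp add: h_def cis_mult[symmetric])
  have h0: "h x \<ge> 0" for x by (simp add: h_def)
  define \<psi> where "\<psi> = (\<lambda>\<theta>. \<theta> - 2 * Im (Ln (1 + cnj a * cis \<theta>)))"
  define \<psi>' where "\<psi>' = (\<lambda>\<theta>. Re ((1 - cnj a * cis \<theta>) / (1 + cnj a * cis \<theta>)))"
  note mob = moebius_on_circle[OF a, folded \<psi>_def \<psi>'_def]
  define m where "m = (\<lambda>w. (w + a) / (1 + cnj a * w))"
  have nz: "1 + cnj a * w \<noteq> 0" if "norm w < 2" for w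
  proof
    assume "1 + cnj a * w = 0"
    then have "norm (cnj a * w) = 1" by (metis add_eq_0_iff norm_minus_cancel norm_one)
    moreover have "norm a * norm w \<le> 1/2 * norm w" using a by (intro mult_right_mono) auto
    ultimately show False using that by (simp add: norm_mult)
  qed
  have "m holomorphic_on ball 0 2"
    unfolding m_def using nz by (intro holomorphic_intros) auto
  then have "(\<lambda>w. g (m w)) holomorphic_on ball 0 2"
    using holomorphic_on_compose_gen[of m "ball 0 2" g UNIV, unfolded o_def] g by blast
  then have "2 * pi * ln (max 1 (norm (g (m 0)))) \<le> integral {0..2 * pi} (\<lambda>\<theta>. ln (max 1 (norm (g (m (cis \<theta>))))))"
    by (rule ln_max_mean_le) simp
  then have 1: "2 * pi * ln (max 1 (norm (g a))) \<le> integral {0..2 * pi} (\<lambda>\<theta>. h (\<psi> \<theta>))"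
    using mob(1) by (simp add: m_def h_def \<psi>_def)
  have \<psi>0: "\<bar>\<psi> \<theta> - \<theta>\<bar> \<le> 2 * pi" if "\<theta> \<in> {0..2 * pi}" for \<theta>
  proof -
    have "1 + cnj a * cis \<theta> \<noteq> 0" by (rule nz) simp
    then have "\<bar>Im (Ln (1 + cnj a * cis \<theta>))\<bar> \<le> pi"
      using mpi_less_Im_Ln[of "1 + cnj a * cis \<theta>"] Im_Ln_le_pi[of "1 + cnj a * cis \<theta>"] by linarith
    then show ?thesis by (simp add: \<psi>_def)
  qed
  have \<psi>2: "\<psi> (2 * pi) = \<psi> 0 + 2 * pi" by (simp add: \<psi>_def)
  \<comment> \<open>Change of variables to the new angle, which advances by exactly one period. The
    weight \<open>\<psi>'\<close> is at least 1/3, so dropping it afterwards costs a factor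
    3.\<close>
  have "((\<lambda>x. \<psi>' x *\<^sub>R h (\<psi> x)) has_integral (integral {\<psi> 0..\<psi> (2 * pi)} h)) {0..2 * pi}"
  proof (rule has_integral_substitution)
    show "\<psi> ` {0..2 * pi} \<subseteq> {- 4 * pi..4 * pi}"
    proof (intro image_subsetI)
      fix \<theta> assume "\<theta> \<in> {0..2 * pi}"
      then show "\<psi> \<theta> \<in> {- 4 * pi..4 * pi}" using \<psi>0[of \<theta>] by auto
    qed
    show "continuous_on {- 4 * pi..4 * pi} h" using ch continuous_on_subset by blast
  qed (use \<psi>2 mob(2) in \<open>auto simp: \<psi>'_def\<close>)
  moreover have "integral {\<psi> 0..\<psi> (2 * pi)} h = integral {0..2 * pi} h"
    unfolding \<psi>2 by (rule integral_periodic[OF ch per]) (use \<psi>0[of 0] in auto)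
  ultimately have sub: "((\<lambda>x. 3 * (\<psi>' x * h (\<psi> x))) has_integral (3 * integral {0..2 * pi} h)) {0..2 * pi}"
    using has_integral_mult_right[of _ _ _ 3] by (simp add: mult.assoc)
  have cpsi: "continuous_on {0..2 * pi} \<psi>"
    by (rule DERIV_continuous_on) (rule mob(2))
  have "continuous_on {0..2 * pi} (\<lambda>\<theta>. h (\<psi> \<theta>))"
    by (rule continuous_on_compose2[OF ch cpsi]) auto
  then have "integral {0..2 * pi} (\<lambda>\<theta>. h (\<psi> \<theta>)) \<le> 3 * integral {0..2 * pi} h"
  proof (intro has_integral_le[OF integrable_integral[OF integrable_continuous_real] sub])
    fix \<theta> assume "\<theta> \<in> {0..2 * pi}"
    have "1 * h (\<psi> \<theta>) \<le> (3 * \<psi>' \<theta>) * h (\<psi> \<theta>)"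
      using mob(3)[of \<theta>] h0 by (intro mult_right_mono) (auto simp: \<psi>'_def)
    then show "h (\<psi> \<theta>) \<le> 3 * (\<psi>' \<theta> * h (\<psi> \<theta>))" by simp
  qed
  then show ?thesis using 1 unfolding h_def by linarith
qed

section \<open>Cauchy potentials on circles\<close>

text \<open>Infinite at 0, so that no exceptional null sets occur in the pointwise estimates.\<close>

definition inv_sqrt :: "real \<Rightarrow> ennreal" where
  "inv_sqrt x = inverse (ennreal (sqrt \<bar>x\<bar>))"

lemma inv_sqrt_measurable [measurable]: "inv_sqrt \<in> borel_measurable borel"
  unfolding inv_sqrt_def[abs_def] by measurable

text \<open>No case has to be excluded at 0: the inverse of a finite number is never 0, so both
  sides are then \<open>top\<close>.\<close>

lemma inverse_ennreal_mult:
  assumes "x \<ge> 0" "y \<ge> 0"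
  shows "inverse (ennreal (x * y)) = inverse (ennreal x) * inverse (ennreal y)"
proof (cases "x = 0 \<or> y = 0")
  case True
  then show ?thesis using assms 
    by (cases "x = 0"; cases "y = 0") (auto simp: inverse_ennreal ennreal_mult_top ennreal_top_mult)
next
  case False
  then show ?thesis using assms by (simp add: inverse_ennreal ennreal_mult[symmetric])
qed

lemma inverse_ennreal_antimono:
  assumes "0 \<le> x" "x \<le> y"
  shows "inverse (ennreal y) \<le> inverse (ennreal x)"
  using assms by (cases "x = 0") (auto simp: inverse_ennreal intro!: ennreal_leI le_imp_inverse_le)

lemma inv_sqrt_mono: "\<bar>x\<bar> \<le> \<bar>y\<bar> \<Longrightarrow> inv_sqrt y \<le> inv_sqrt x"
  unfolding inv_sqrt_def by (intro inverse_ennreal_antimono) auto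

section \<open>Integrals of the inverse distance over circles and annuli\<close>

lemma nn_integral_inv_sqrt_le:
  assumes L: "L \<ge> 0" and sub: "{a..b} \<subseteq> {c - L..c + L}"
  shows "(\<integral>\<^sup>+x\<in>{a..b}. inv_sqrt (x - c) \<partial>lborel) \<le> ennreal (4 * sqrt L)"
proof -
  let ?f = "\<lambda>x::real. \<bar>x\<bar> powr (-1/2)"
  have "((\<lambda>x::real. x powr (-1/2)) has_integral (L powr (-1/2 + 1) / (-1/2 + 1))) {0..L}"
    by (rule has_integral_powr_from_0) (use L in auto)
  then have 1: "(?f has_integral (2 * sqrt L)) {0..L}"
    using L by (subst has_integral_cong[where g = "\<lambda>x. x powr (-1/2)"]) (auto simp: powr_half_sqrt mult.commute)
  then have 2: "(?f has_integral (2 * sqrt L)) {-L..0}"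
    using has_integral_reflect_real[of ?f "2 * sqrt L" L 0] by simp
  have "(?f has_integral (2 * sqrt L + 2 * sqrt L)) {-L..L}"
    by (rule has_integral_combine[OF _ _ 2 1]) (use L in auto)
  then have 3: "(\<integral>\<^sup>+x. ennreal (?f x) * indicator {-L..L} x \<partial>lborel) = ennreal (4 * sqrt L)"
    by (subst nn_integral_has_integral_lebesgue') auto
  have "(\<integral>\<^sup>+x\<in>{a..b}. inv_sqrt (x - c) \<partial>lborel) \<le> (\<integral>\<^sup>+x\<in>{c - L..c + L}. inv_sqrt (x - c) \<partial>lborel)"
    by (rule nn_set_integral_set_mono[OF sub])
  also have "\<dots> = (\<integral>\<^sup>+x. inv_sqrt x * indicator {-L..L} x \<partial>lborel)"
    by (subst nn_integral_real_affine[where c = 1 and t = c])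
       (auto intro!: nn_integral_cong simp: indicator_def)
  also have "\<dots> = (\<integral>\<^sup>+x. ennreal (?f x) * indicator {-L..L} x \<partial>lborel)"
  proof (rule nn_integral_cong_AE)
    \<comment> \<open>The integrands differ at 0, where \<open>inv_sqrt\<close> is infinite while
      \<open>powr\<close> has the value 0.\<close>
    show "AE x in lborel. inv_sqrt x * indicator {-L..L} x = ennreal (?f x) * indicator {-L..L} x"
      using AE_lborel_singleton[of "0::real"]
    proof eventually_elim
      case (elim x)
      then show ?case
        by (simp add: inv_sqrt_def inverse_ennreal powr_minus powr_half_sqrt)
    qed
  qed
  finally show ?thesis using 3 by simp
qed

text \<open>The Taylor estimate would even give |y| / 2. The divisor 4 is a perfect square, so that
  \<open>inv_sqrt\<close> later turns it into the plain factor 2.\<close>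

lemma abs_sin_ge:
  fixes y :: real
  assumes "\<bar>y\<bar> \<le> pi / 2"
  shows "\<bar>y\<bar> / 4 \<le> \<bar>sin y\<bar>"
proof -
  have "\<bar>sin y - (\<Sum>m<3. sin_coeff m * y ^ m)\<bar> \<le> inverse (fact 3) * \<bar>y\<bar> ^ 3"
    by (rule Maclaurin_sin_bound)
  then have "\<bar>sin y - y\<bar> \<le> \<bar>y\<bar> ^ 3 / 6"
    by (simp add: eval_nat_numeral sin_coeff_def fact_numeral)
  moreover have "\<bar>y\<bar> \<le> 1.6" using assms pi_approx by simp
  then have "\<bar>y\<bar> * \<bar>y\<bar> \<le> 1.6 * 1.6" by (intro mult_mono) auto
  then have "\<bar>y\<bar> * (\<bar>y\<bar> * \<bar>y\<bar>) \<le> \<bar>y\<bar> * 3" by (intro mult_left_mono) auto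
  then have "\<bar>y\<bar> ^ 3 \<le> 3 * \<bar>y\<bar>" by (simp add: power3_eq_cube mult_ac)
  ultimately show ?thesis by linarith
qed

text \<open>The range is what \<theta> - \<alpha> can reach for \<theta> in
  \<open>{0..2 * pi}\<close> and an argument \<alpha>. Every point of it lies within
  \<open>pi / 2\<close> of one of the five zeros of sine listed here, and near that zero sine is
  comparable to the distance from it. Summing over all five avoids depending on which one is
  nearest.\<close>

lemma inv_sqrt_sin_le:
  assumes x: "- pi \<le> x" "x \<le> 3 * pi"
  shows "inv_sqrt (sin x) \<le> (\<Sum>j\<in>{-1..3::int}. 2 * inv_sqrt (x - of_int j * pi))"
proof -
  have "\<exists>j\<in>{-1..3::int}. \<bar>x - of_int j * pi\<bar> \<le> pi / 2"
  proof -
    consider "x \<le> - pi / 2" | "- pi / 2 \<le> x" "x \<le> pi / 2" | "pi / 2 \<le> x" "x \<le> 3 / 2 * pi"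
      | "3 / 2 * pi \<le> x" "x \<le> 5 / 2 * pi" | "5 / 2 * pi \<le> x" by linarith
    then show ?thesis
    proof cases
      case 1 then show ?thesis using x by (intro bexI[of _ "-1"]) (auto simp: abs_le_iff)
    next
      case 2 then show ?thesis by (intro bexI[of _ 0]) auto
    next
      case 3 then show ?thesis by (intro bexI[of _ 1] abs_leI) auto
    next
      case 4 then show ?thesis by (intro bexI[of _ 2] abs_leI) auto
    next
      case 5 then show ?thesis using x by (intro bexI[of _ 3]) (auto simp: abs_le_iff)
    qed
  qed
  then obtain j where j: "j \<in> {-1..3::int}" "\<bar>x - of_int j * pi\<bar> \<le> pi / 2" by blast
  let ?y = "x - of_int j * pi"
  have "sin ?y = sin x * cos (of_int j * pi)" by (simp add: sin_diff sin_npi_int mult.commute[of _ pi])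
  then have "\<bar>sin ?y\<bar> = \<bar>sin x\<bar>" by (simp add: abs_mult cos_npi_int mult.commute[of _ pi])
  then have "\<bar>?y / 4\<bar> \<le> \<bar>sin x\<bar>" using abs_sin_ge[OF j(2)] by simp
  then have "inv_sqrt (sin x) \<le> inv_sqrt (?y / 4)" by (rule inv_sqrt_mono)
  also have "\<dots> = inverse (ennreal (1 / 2 * sqrt \<bar>?y\<bar>))"
    by (simp add: inv_sqrt_def real_sqrt_divide)
  also have "\<dots> = inverse (ennreal (1 / 2)) * inv_sqrt ?y"
    unfolding inv_sqrt_def by (rule inverse_ennreal_mult) auto
  also have "inverse (ennreal (1 / 2)) * inv_sqrt ?y = 2 * inv_sqrt ?y"
    using inverse_ennreal[of "1 / 2"] by simp
  also have "\<dots> \<le> (\<Sum>j\<in>{-1..3::int}. 2 * inv_sqrt (x - of_int j * pi))"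
    by (rule member_le_sum[OF j(1)]) auto
  finally show ?thesis .
qed

text \<open>The distance dominates both |r - s| and r |sin (\<theta> - \<alpha>)|, hence their geometric mean,
  whose inverse is integrable in each of the variables r and \<theta>.\<close>

lemma inverse_dist_polar_le:
  assumes rs: "r \<ge> 0" "s \<ge> 0"
  shows "inverse (ennreal (norm (rcis r \<theta> - rcis s \<alpha>)))
     \<le> inv_sqrt (r - s) * (inv_sqrt r * inv_sqrt (sin (\<theta> - \<alpha>)))"
proof -
  let ?z = "rcis r (\<theta> - \<alpha>) - of_real s"
  \<comment> \<open>Rotating the second point onto the positive real axis makes r |sin (\<theta> -
    \<alpha>)| the absolute value of the imaginary part of the difference.\<close>
  have "rcis r \<theta> = cis \<alpha> * rcis r (\<theta> - \<alpha>)"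
    by (simp add: rcis_def mult.left_commute[of "cis \<alpha>"] cis_mult)
  then have "rcis r \<theta> - rcis s \<alpha> = cis \<alpha> * ?z"
    by (simp add: rcis_def right_diff_distrib mult.commute)
  then have n: "norm (rcis r \<theta> - rcis s \<alpha>) = norm ?z" by (simp add: norm_mult)
  have Im: "r * \<bar>sin (\<theta> - \<alpha>)\<bar> \<le> norm ?z"
    using abs_Im_le_cmod[of ?z] rs by (simp add: rcis_def abs_mult)
  have tri: "\<bar>r - s\<bar> \<le> norm ?z"
    using norm_triangle_ineq3[of "rcis r (\<theta> - \<alpha>)" "of_real s"] rs by simp
  have "sqrt \<bar>r - s\<bar> * (sqrt \<bar>r\<bar> * sqrt \<bar>sin (\<theta> - \<alpha>)\<bar>) = sqrt (\<bar>r - s\<bar> * (r * \<bar>sin (\<theta> - \<alpha>)\<bar>))"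
    using rs by (simp add: real_sqrt_mult)
  also have "\<dots> \<le> sqrt (norm ?z * norm ?z)"
    by (intro real_sqrt_le_mono mult_mono Im tri) (use rs in auto)
  finally have le: "sqrt \<bar>r - s\<bar> * (sqrt \<bar>r\<bar> * sqrt \<bar>sin (\<theta> - \<alpha>)\<bar>) \<le> norm ?z" by simp
  have "inverse (ennreal (norm ?z)) \<le> inverse (ennreal (sqrt \<bar>r - s\<bar> * (sqrt \<bar>r\<bar> * sqrt \<bar>sin (\<theta> - \<alpha>)\<bar>)))"
    by (rule inverse_ennreal_antimono[OF _ le]) auto
  also have "\<dots> = inv_sqrt (r - s) * (inv_sqrt r * inv_sqrt (sin (\<theta> - \<alpha>)))"
    by (simp add: inverse_ennreal_mult inv_sqrt_def)
  finally show ?thesis unfolding n .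
qed

text \<open>The bound is infinite when the circle passes through \<open>z\<close>, but it is
  integrable in \<open>r\<close>, which is how it is used. The constant collects five zeros of sine,
  a factor 2 for each, and \<open>4 * sqrt (6 * pi)\<close> for the integral around each
  zero.\<close>

lemma nn_integral_circle_inverse_dist_le:
  assumes r: "r \<ge> 0"
  shows "(\<integral>\<^sup>+\<theta>\<in>{0..2 * pi}. inverse (ennreal (norm (p + rcis r \<theta> - z))) \<partial>lborel)
     \<le> inv_sqrt (r - norm (z - p)) * (inv_sqrt r * ennreal (40 * sqrt (6 * pi)))"
proof -
  define s \<alpha> where "s = norm (z - p)" and "\<alpha> = Arg (z - p)"
  have zp: "p + rcis r \<theta> - z = rcis r \<theta> - rcis s \<alpha>" for \<theta>
    by (simp add: s_def \<alpha>_def rcis_cmod_Arg)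
  have \<alpha>: "- pi < \<alpha>" "\<alpha> \<le> pi" using mpi_less_Arg[of "z - p"] Arg_le_pi[of "z - p"] by (auto simp: \<alpha>_def)
  have j: "(\<integral>\<^sup>+\<theta>\<in>{0..2 * pi}. inv_sqrt (\<theta> - (\<alpha> + of_int j * pi)) \<partial>lborel) \<le> ennreal (4 * sqrt (6 * pi))"
    if j: "j \<in> {-1..3}" for j :: int
  proof (rule nn_integral_inv_sqrt_le)
    \<comment> \<open>The singularities \<alpha> + j pi lie between -2 pi and 4 pi, so an interval
      of half-length 6 pi around any of them covers \<open>{0..2 * pi}\<close>.\<close>
    have "-1 * pi \<le> of_int j * pi" "of_int j * pi \<le> 3 * pi"
      using j mult_right_mono[of "-1" "of_int j" pi] mult_right_mono[of "of_int j" 3 pi] by simp_all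
    then show "{0..2 * pi} \<subseteq> {\<alpha> + of_int j * pi - 6 * pi..\<alpha> + of_int j * pi + 6 * pi}"
      using \<alpha> unfolding atLeastatMost_subset_iff by linarith
  qed auto
  have "(\<integral>\<^sup>+\<theta>\<in>{0..2 * pi}. inverse (ennreal (norm (p + rcis r \<theta> - z))) \<partial>lborel)
     \<le> (\<integral>\<^sup>+\<theta>. (inv_sqrt (r - s) * inv_sqrt r * 2) *
          (\<Sum>j\<in>{-1..3::int}. inv_sqrt (\<theta> - (\<alpha> + of_int j * pi)) * indicator {0..2 * pi} \<theta>) \<partial>lborel)"
  proof (rule nn_integral_mono)
    fix \<theta> :: real
    show "inverse (ennreal (norm (p + rcis r \<theta> - z))) * indicator {0..2 * pi} \<theta>
      \<le> (inv_sqrt (r - s) * inv_sqrt r * 2) *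
          (\<Sum>j\<in>{-1..3::int}. inv_sqrt (\<theta> - (\<alpha> + of_int j * pi)) * indicator {0..2 * pi} \<theta>)"
    proof (cases "\<theta> \<in> {0..2 * pi}")
      case True
      have "inverse (ennreal (norm (p + rcis r \<theta> - z))) \<le> inv_sqrt (r - s) * (inv_sqrt r * inv_sqrt (sin (\<theta> - \<alpha>)))"
        unfolding zp by (rule inverse_dist_polar_le) (use r in \<open>auto simp: s_def\<close>)
      also have "\<dots> \<le> inv_sqrt (r - s) * (inv_sqrt r * (\<Sum>j\<in>{-1..3::int}. 2 * inv_sqrt (\<theta> - \<alpha> - of_int j * pi)))"
        by (intro mult_left_mono inv_sqrt_sin_le) (use True \<alpha> in auto)
      also have "\<dots> = (inv_sqrt (r - s) * inv_sqrt r * 2) * (\<Sum>j\<in>{-1..3::int}. inv_sqrt (\<theta> - (\<alpha> + of_int j * pi)))"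
        by (simp only: sum_distrib_left mult_ac diff_diff_eq)
      finally show ?thesis using True by simp
    qed simp
  qed
  also have "\<dots> = (inv_sqrt (r - s) * inv_sqrt r * 2) *
     (\<integral>\<^sup>+\<theta>. (\<Sum>j\<in>{-1..3::int}. inv_sqrt (\<theta> - (\<alpha> + of_int j * pi)) * indicator {0..2 * pi} \<theta>) \<partial>lborel)"
    by (rule nn_integral_cmult) measurable
  also have "(\<integral>\<^sup>+\<theta>. (\<Sum>j\<in>{-1..3::int}. inv_sqrt (\<theta> - (\<alpha> + of_int j * pi)) * indicator {0..2 * pi} \<theta>) \<partial>lborel)
     = (\<Sum>j\<in>{-1..3::int}. \<integral>\<^sup>+\<theta>\<in>{0..2 * pi}. inv_sqrt (\<theta> - (\<alpha> + of_int j * pi)) \<partial>lborel)"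
    by (rule nn_integral_sum) measurable
  also have "(inv_sqrt (r - s) * inv_sqrt r * 2) *
      (\<Sum>j\<in>{-1..3::int}. \<integral>\<^sup>+\<theta>\<in>{0..2 * pi}. inv_sqrt (\<theta> - (\<alpha> + of_int j * pi)) \<partial>lborel)
     \<le> (inv_sqrt (r - s) * inv_sqrt r * 2) * (\<Sum>j\<in>{-1..3::int}. ennreal (4 * sqrt (6 * pi)))"
    by (intro mult_left_mono sum_mono j) auto
  also have "\<dots> = inv_sqrt (r - s) * (inv_sqrt r * ennreal (40 * sqrt (6 * pi)))"
    by (simp add: mult.assoc ennreal_mult'[symmetric] flip: ennreal_numeral)
  finally show ?thesis by (simp add: s_def)
qed

text \<open>The first bound is independent of R: the integral of |r - s|^(-1/2) over the radii is of
  order sqrt R and cancels the factor r^(-1/2). The second one gives decay for distant points: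
  beyond 8R the distance to the annulus is at least half the distance to its centre, and the
  rectangle of radii and angles has area 4 pi R.\<close>

lemma nn_integral_annulus_inverse_dist_le:
  assumes R: "R \<ge> 1"
  shows "(\<integral>\<^sup>+r\<in>{2 * R..4 * R}. (\<integral>\<^sup>+\<theta>\<in>{0..2 * pi}. inverse (ennreal (norm (p + rcis r \<theta> - z))) \<partial>lborel) \<partial>lborel)
     \<le> ennreal (320 * sqrt (6 * pi))"
    (is "?I \<le> _")
  and "norm (z - p) > 8 * R \<Longrightarrow>
     (\<integral>\<^sup>+r\<in>{2 * R..4 * R}. (\<integral>\<^sup>+\<theta>\<in>{0..2 * pi}. inverse (ennreal (norm (p + rcis r \<theta> - z))) \<partial>lborel) \<partial>lborel)
     \<le> ennreal (8 * pi * R / norm (z - p))"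
proof -
  define s where "s = norm (z - p)"
  show far: "?I \<le> ennreal (8 * pi * R / norm (z - p))" if "norm (z - p) > 8 * R"
  proof -
    have s: "s > 8 * R" using that by (simp add: s_def)
    have "?I \<le> (\<integral>\<^sup>+r\<in>{2 * R..4 * R}. (\<integral>\<^sup>+\<theta>\<in>{0..2 * pi}. ennreal (2 / s) \<partial>lborel) \<partial>lborel)"
    proof (intro nn_integral_mono)
      fix r :: real
      show "(\<integral>\<^sup>+\<theta>\<in>{0..2 * pi}. inverse (ennreal (norm (p + rcis r \<theta> - z))) \<partial>lborel) * indicator {2 * R..4 * R} r
        \<le> (\<integral>\<^sup>+\<theta>\<in>{0..2 * pi}. ennreal (2 / s) \<partial>lborel) * indicator {2 * R..4 * R} r"
      proof (cases "r \<in> {2 * R..4 * R}")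
        case True
        have "inverse (ennreal (norm (p + rcis r \<theta> - z))) \<le> ennreal (2 / s)" for \<theta>
        proof -
          have "s \<le> norm (p + rcis r \<theta> - z) + r"
            using norm_triangle_ineq4[of "rcis r \<theta>" "p + rcis r \<theta> - z"] True R by (simp add: s_def)
          then have "s / 2 \<le> norm (p + rcis r \<theta> - z)" using True s by simp
          then have "inverse (ennreal (norm (p + rcis r \<theta> - z))) \<le> inverse (ennreal (s / 2))"
            using s R by (intro inverse_ennreal_antimono) auto
          then show ?thesis using s R by (simp add: inverse_ennreal)
        qed
        then show ?thesis by (intro mult_right_mono nn_integral_mono) auto
      qed simp
    qed
    also have "\<dots> = ennreal (2 / s) * ennreal (2 * pi) * ennreal (2 * R)"
      using R by (simp add: nn_integral_cmult_indicator)
    also have "\<dots> = ennreal (8 * pi * R / s)"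
      using R s by (simp add: ennreal_mult[symmetric])
    finally show ?thesis by (simp add: s_def)
  qed
  show "?I \<le> ennreal (320 * sqrt (6 * pi))"
  proof (cases "s > 8 * R")
    case True
    have "8 * pi * R / s \<le> pi" using True R by (simp add: field_simps)
    also have "\<dots> \<le> 320 * sqrt (6 * pi)"
    proof -
      have "pi \<le> 1 * 4" using pi_less_4 by simp
      also have "\<dots> \<le> sqrt (6 * pi) * 320" using pi_gt3 by (intro mult_mono) auto
      finally show ?thesis by simp
    qed
    finally show ?thesis using far[folded s_def, OF True] by (meson ennreal_leI order_trans)
  next
    case False
    have "?I \<le> (\<integral>\<^sup>+r. (inv_sqrt (2 * R) * ennreal (40 * sqrt (6 * pi))) * (inv_sqrt (r - s) * indicator {2 * R..4 * R} r) \<partial>lborel)"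
    proof (intro nn_integral_mono)
      fix r :: real
      show "(\<integral>\<^sup>+\<theta>\<in>{0..2 * pi}. inverse (ennreal (norm (p + rcis r \<theta> - z))) \<partial>lborel) * indicator {2 * R..4 * R} r
        \<le> (inv_sqrt (2 * R) * ennreal (40 * sqrt (6 * pi))) * (inv_sqrt (r - s) * indicator {2 * R..4 * R} r)"
      proof (cases "r \<in> {2 * R..4 * R}")
        case True
        have "(\<integral>\<^sup>+\<theta>\<in>{0..2 * pi}. inverse (ennreal (norm (p + rcis r \<theta> - z))) \<partial>lborel)
          \<le> inv_sqrt (r - s) * (inv_sqrt r * ennreal (40 * sqrt (6 * pi)))"
          unfolding s_def by (rule nn_integral_circle_inverse_dist_le) (use True R in auto)
        also have "\<dots> \<le> inv_sqrt (r - s) * (inv_sqrt (2 * R) * ennreal (40 * sqrt (6 * pi)))"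
          by (intro mult_left_mono mult_right_mono inv_sqrt_mono) (use True R in auto)
        finally show ?thesis using True by (simp add: mult_ac)
      qed simp
    qed
    also have "\<dots> = (inv_sqrt (2 * R) * ennreal (40 * sqrt (6 * pi))) * (\<integral>\<^sup>+r\<in>{2 * R..4 * R}. inv_sqrt (r - s) \<partial>lborel)"
      by (rule nn_integral_cmult) auto
    also have "\<dots> \<le> (inv_sqrt (2 * R) * ennreal (40 * sqrt (6 * pi))) * ennreal (4 * sqrt (8 * R))"
      using False R by (intro mult_left_mono nn_integral_inv_sqrt_le) (auto simp: s_def intro: order_trans[OF _ norm_ge_zero])
    also have "\<dots> = ennreal (inverse (sqrt (2 * R)) * (40 * sqrt (6 * pi)) * (4 * sqrt (8 * R)))"
      using R by (simp add: inv_sqrt_def inverse_ennreal ennreal_mult[symmetric])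
    also have "sqrt (8 * R) = 2 * sqrt (2 * R)"
      using real_sqrt_mult[of 4 "2 * R"] by simp
    also have "inverse (sqrt (2 * R)) * (40 * sqrt (6 * pi)) * (4 * (2 * sqrt (2 * R))) = 320 * sqrt (6 * pi)"
      using R by simp
    finally show ?thesis .
  qed
qed

text \<open>Infinite at the points t n with w n > 0.\<close>

definition cauchy_potential :: "(nat \<Rightarrow> real) \<Rightarrow> (nat \<Rightarrow> complex) \<Rightarrow> complex \<Rightarrow> ennreal" where
  "cauchy_potential w t z = (\<Sum>n. ennreal (w n) * inverse (ennreal (norm (z - t n))))"

lemma cauchy_potential_polar_measurable [measurable]:
  "(\<lambda>(r, \<theta>). cauchy_potential w t (p + rcis r \<theta>)) \<in> borel_measurable (borel \<Otimes>\<^sub>M borel)"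
proof -
  have [measurable]: "(\<lambda>x::real \<times> real. p + rcis (fst x) (snd x) - t n) \<in> borel_measurable (borel \<Otimes>\<^sub>M borel)" for n
    unfolding borel_prod rcis_def
    by (intro borel_measurable_continuous_onI continuous_intros)
  show ?thesis
    unfolding cauchy_potential_def case_prod_beta by measurable
qed

lemma cauchy_potential_circle_measurable:
  "(\<lambda>\<theta>. cauchy_potential w t (p + rcis r \<theta>)) \<in> borel_measurable borel"
  using measurable_compose[OF _ cauchy_potential_polar_measurable, of "\<lambda>\<theta>. (r, \<theta>)" borel] by simp

lemma nn_set_integral_suminf_cmult:
  fixes c :: "nat \<Rightarrow> ennreal"
  assumes f: "\<And>n. f n \<in> borel_measurable M" and A: "A \<in> sets M"
  shows "(\<integral>\<^sup>+x\<in>A. (\<Sum>n. c n * f n x) \<partial>M) = (\<Sum>n. c n * (\<integral>\<^sup>+x\<in>A. f n x \<partial>M))"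
proof -
  have m: "(\<lambda>x. f n x * indicator A x) \<in> borel_measurable M" for n
    using f A by simp
  have "(\<integral>\<^sup>+x\<in>A. (\<Sum>n. c n * f n x) \<partial>M) = (\<integral>\<^sup>+x. (\<Sum>n. c n * (f n x * indicator A x)) \<partial>M)"
    by (simp only: ennreal_suminf_multc[symmetric] mult.assoc)
  also have "\<dots> = (\<Sum>n. \<integral>\<^sup>+x. c n * (f n x * indicator A x) \<partial>M)"
    by (rule nn_integral_suminf) (use m in simp)
  also have "\<dots> = (\<Sum>n. c n * (\<integral>\<^sup>+x\<in>A. f n x \<partial>M))"
    by (simp only: nn_integral_cmult[OF m])
  finally show ?thesis .
qed

text \<open>Dominated convergence for series (Tannery's theorem), after division by R. The
  contribution of a single \<open>t n\<close> is at most \<open>a n R\<close>: the uniform bound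
  makes it tend to 0 for fixed n, and the decay for distant points supplies a summable
  majorant.\<close>

lemma nn_integral_annulus_potential_tendsto_0:
  assumes w: "\<And>n. w n \<ge> 0" and sum: "summable (\<lambda>n. w n / (1 + norm (t n)))"
    and \<epsilon>: "\<epsilon> > 0"
  obtains R0 where "R0 \<ge> 1" "\<And>R. R \<ge> R0 \<Longrightarrow>
    (\<integral>\<^sup>+r\<in>{2 * R..4 * R}. (\<integral>\<^sup>+\<theta>\<in>{0..2 * pi}. cauchy_potential w t (p + rcis r \<theta>) \<partial>lborel) \<partial>lborel) \<le> ennreal (\<epsilon> * R)"
proof -
  define C where "C = 320 * sqrt (6 * pi)"
  \<comment> \<open>One constant for both positions of \<open>t n\<close>. If its distance s to
    \<open>p\<close> is at most 8R, then 1 + s \<le> 9R and \<open>9 * C\<close> suffices; otherwise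
    1 + s \<le> 2s and \<open>16 * pi\<close> does. The factor \<open>1 + norm p\<close> passes from
    the distance to \<open>p\<close> to the modulus.\<close>
  define C' where "C' = (9 * C + 16 * pi) * (1 + norm p)"
  define a where "a = (\<lambda>n R. w n * min (C / R) (C' / (1 + norm (t n))))"
  have C: "C > 0" by (simp add: C_def)
  then have C': "C' > 0" unfolding C'_def by (intro mult_pos_pos add_pos_nonneg) auto
  have sumM: "summable (\<lambda>n. C' * (w n / (1 + norm (t n))))"
    using sum by (rule summable_mult)
  have a0: "a n R \<ge> 0" if "R \<ge> 1" for n R
    unfolding a_def using w[of n] C C' that by (intro mult_nonneg_nonneg) (auto intro!: divide_nonneg_nonneg)
  have aM: "a n R \<le> C' * (w n / (1 + norm (t n)))" for n R
  proof -
    have "a n R \<le> w n * (C' / (1 + norm (t n)))"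
      unfolding a_def by (intro mult_left_mono w) auto
    then show ?thesis by (simp add: mult_ac)
  qed
  have suma: "summable (\<lambda>n. a n R)" if "R \<ge> 1" for R
    by (rule summable_comparison_test[OF _ sumM]) (use aM a0 that in auto)
  have "((\<lambda>R. \<Sum>n. a n R) \<longlongrightarrow> (\<Sum>n. 0)) at_top"
  proof (rule tannerys_theorem[THEN conjunct2, THEN conjunct2])
    show "((\<lambda>R. a n R) \<longlongrightarrow> 0) at_top" for n
    proof (rule tendsto_sandwich)
      show "\<forall>\<^sub>F R in at_top. 0 \<le> a n R"
        using eventually_ge_at_top[of 1] by eventually_elim (rule a0)
      show "\<forall>\<^sub>F R in at_top. a n R \<le> w n * (C / R)"
        by (intro always_eventually allI) (simp only: a_def, intro mult_left_mono w min.cobounded1)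
      show "((\<lambda>R. w n * (C / R)) \<longlongrightarrow> 0) at_top"
        by (intro tendsto_mult_right_zero tendsto_divide_0[OF tendsto_const]) (rule filterlim_at_top_imp_at_infinity[OF filterlim_ident])
    qed simp
    have "\<forall>\<^sub>F R in at_top. \<forall>n. norm (a n R) \<le> C' * (w n / (1 + norm (t n)))"
      using eventually_ge_at_top[of "1::real"] by eventually_elim (use a0 aM in auto)
    then show "\<forall>\<^sub>F (n, R) in at_top \<times>\<^sub>F at_top. norm (a n R) \<le> C' * (w n / (1 + norm (t n)))"
      unfolding case_prod_beta
      by (subst eventually_prod_filter) 
         (auto intro!: exI[of _ "\<lambda>_. True"] exI[of _ "\<lambda>R. \<forall>n. norm (a n R) \<le> C' * (w n / (1 + norm (t n)))"])
  qed (use sumM in auto)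
  then have "\<forall>\<^sub>F R in at_top. (\<Sum>n. a n R) < \<epsilon>" using \<epsilon> by (simp add: order_tendstoD)
  then obtain R1 where R1: "\<And>R. R \<ge> R1 \<Longrightarrow> (\<Sum>n. a n R) < \<epsilon>"
    by (auto simp: eventually_at_top_linorder)
  show ?thesis
  proof (rule that[of "max 1 R1"])
    fix R assume R: "R \<ge> max 1 R1"
    then have R1': "R \<ge> 1" by simp
    define K where "K = (\<lambda>n. \<integral>\<^sup>+r\<in>{2 * R..4 * R}. (\<integral>\<^sup>+\<theta>\<in>{0..2 * pi}. inverse (ennreal (norm (p + rcis r \<theta> - t n))) \<partial>lborel) \<partial>lborel)"
    have K: "ennreal (w n) * K n \<le> ennreal (a n R * R)" for n
    proof -
      define s where "s = norm (t n - p)"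
      have tn: "1 + norm (t n) \<le> (1 + norm p) * (1 + s)"
      proof -
        have "norm (t n) \<le> norm p + s" using norm_triangle_ineq[of p "t n - p"] by (simp add: s_def)
        also have "1 + (norm p + s) \<le> (1 + norm p) * (1 + s)" by (simp add: algebra_simps s_def)
        finally show ?thesis by simp
      qed
      have K1: "K n \<le> ennreal C"
        unfolding C_def K_def by (rule nn_integral_annulus_inverse_dist_le(1)[OF R1'])
      have K2: "K n \<le> ennreal (C' * R / (1 + norm (t n)))"
      proof (cases "s > 8 * R")
        case True
        have "K n \<le> ennreal (8 * pi * R / s)"
          unfolding s_def K_def by (rule nn_integral_annulus_inverse_dist_le(2)[OF R1']) (use True s_def in auto)
        also have "8 * pi * R / s \<le> C' * R / (1 + norm (t n))"
        proof -
          have "8 * pi * R * (1 + norm (t n)) \<le> 8 * pi * R * ((1 + norm p) * (2 * s))"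
            by (intro mult_left_mono order_trans[OF tn]) (use True R1' in auto)
          also have "\<dots> = (0 * C + 16 * pi) * (1 + norm p) * R * s" by simp
          also have "\<dots> \<le> C' * R * s"
            unfolding C'_def using C R1' True by (intro mult_right_mono add_right_mono) auto
          finally have "8 * pi * R * (1 + norm (t n)) \<le> C' * R * s" .
          moreover have "1 + norm (t n) > 0" "s > 0"
            using True R1' by (auto intro: add_pos_nonneg)
          ultimately show ?thesis
            by (simp only: pos_divide_le_eq times_divide_eq_left pos_le_divide_eq)
        qed
        finally show ?thesis by (simp add: ennreal_leI)
      next
        case False
        have "C * (1 + norm (t n)) \<le> C * ((1 + norm p) * (9 * R))"
          by (intro mult_left_mono order_trans[OF tn]) (use False R1' C in auto)
        also have "\<dots> = (9 * C + 0) * (1 + norm p) * R" by simp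
        also have "\<dots> \<le> C' * R"
          unfolding C'_def using R1' by (intro mult_right_mono add_left_mono) auto
        finally have "C \<le> C' * R / (1 + norm (t n))"
          by (simp add: pos_le_divide_eq add_pos_nonneg)
        then show ?thesis using K1 by (meson ennreal_leI order_trans)
      qed
      have "K n \<le> ennreal (min C (C' * R / (1 + norm (t n))))"
        using K1 K2 by (simp add: min_def)
      moreover have "min C (C' * R / (1 + norm (t n))) = min (C / R) (C' / (1 + norm (t n))) * R"
        using R1' by (simp add: min_mult_distrib_right)
      ultimately have "K n \<le> ennreal (min (C / R) (C' / (1 + norm (t n))) * R)" by simp
      then have "ennreal (w n) * K n \<le> ennreal (w n) * ennreal (min (C / R) (C' / (1 + norm (t n))) * R)"
        by (rule mult_left_mono) simp
      then show ?thesis by (simp add: a_def ennreal_mult'[OF w, symmetric] mult.assoc)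
    qed
    have [measurable]: "(\<lambda>x::real \<times> real. p + rcis (fst x) (snd x) - t n) \<in> borel_measurable (borel \<Otimes>\<^sub>M borel)" for n
      unfolding borel_prod rcis_def
      by (intro borel_measurable_continuous_onI continuous_intros)
    have m2: "(\<lambda>x. inverse (ennreal (norm (p + rcis (fst x) (snd x) - t n)))) \<in> borel_measurable (borel \<Otimes>\<^sub>M borel)" for n
      by measurable
    have m1: "(\<lambda>\<theta>. inverse (ennreal (norm (p + rcis r \<theta> - t n)))) \<in> borel_measurable borel" for n r
      using measurable_compose[OF _ m2, of "\<lambda>\<theta>. (r, \<theta>)" borel] by simp
    have m3: "(\<lambda>r. \<integral>\<^sup>+\<theta>\<in>{0..2 * pi}. inverse (ennreal (norm (p + rcis r \<theta> - t n))) \<partial>lborel) \<in> borel_measurable borel" for n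
    proof -
      have sets: "borel_measurable (borel \<Otimes>\<^sub>M (lborel :: real measure)) = (borel_measurable (borel \<Otimes>\<^sub>M borel) :: (real \<times> real \<Rightarrow> ennreal) set)"
        by (intro measurable_cong_sets sets_pair_measure_cong) auto
      have "(\<lambda>(r, \<theta>). inverse (ennreal (norm (p + rcis r \<theta> - t n))) * indicator {0..2 * pi} \<theta>)
          \<in> borel_measurable (borel \<Otimes>\<^sub>M lborel)"
        unfolding case_prod_beta sets
        by (intro borel_measurable_times_ennreal m2 measurable_compose[OF measurable_snd borel_measurable_indicator]) auto
      from lborel.borel_measurable_nn_integral[OF this] show ?thesis .
    qed
    have "(\<integral>\<^sup>+r\<in>{2 * R..4 * R}. (\<integral>\<^sup>+\<theta>\<in>{0..2 * pi}. cauchy_potential w t (p + rcis r \<theta>) \<partial>lborel) \<partial>lborel)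
      = (\<integral>\<^sup>+r\<in>{2 * R..4 * R}. (\<Sum>n. ennreal (w n) * (\<integral>\<^sup>+\<theta>\<in>{0..2 * pi}. inverse (ennreal (norm (p + rcis r \<theta> - t n))) \<partial>lborel)) \<partial>lborel)"
      unfolding cauchy_potential_def
      by (subst nn_set_integral_suminf_cmult) (use m1 in simp_all)
    also have "\<dots> = (\<Sum>n. ennreal (w n) * K n)"
      unfolding K_def by (rule nn_set_integral_suminf_cmult) (use m3 in simp_all)
    also have "\<dots> \<le> (\<Sum>n. ennreal (a n R * R))"
      by (intro suminf_le K) auto
    also have "\<dots> = ennreal ((\<Sum>n. a n R) * R)"
      using suma[OF R1'] a0[OF R1'] R1' 
      by (subst suminf_ennreal2) (auto intro: summable_mult2 simp: suminf_mult2)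
    also have "\<dots> \<le> ennreal (\<epsilon> * R)"
      using R1[of R] R by (intro ennreal_leI mult_right_mono) auto
    finally show "(\<integral>\<^sup>+r\<in>{2 * R..4 * R}. (\<integral>\<^sup>+\<theta>\<in>{0..2 * pi}. cauchy_potential w t (p + rcis r \<theta>) \<partial>lborel) \<partial>lborel) \<le> ennreal (\<epsilon> * R)" .
  qed simp
qed

text \<open>The radii fill an interval of length 2R, so a double integral of at most \<kappa>
  \<delta> R leaves some circle whose angular integral is at most \<kappa> \<delta>. Markov's
  inequality on that circle bounds the set of bad angles.\<close>

lemma potential_small_on_circle:
  assumes w: "\<And>n. w n \<ge> 0" and sum: "summable (\<lambda>n. w n / (1 + norm (t n)))"
    and \<kappa>: "\<kappa> > 0" and \<delta>: "\<delta> > 0"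
  obtains R0 where "R0 \<ge> 1" "\<And>R. R \<ge> R0 \<Longrightarrow>
    \<exists>r\<in>{2 * R..4 * R}. emeasure lborel {\<theta>\<in>{0..2 * pi}. ennreal \<kappa> \<le> cauchy_potential w t (p + rcis r \<theta>)} \<le> ennreal \<delta>"
proof -
  let ?I = "\<lambda>r. \<integral>\<^sup>+\<theta>\<in>{0..2 * pi}. cauchy_potential w t (p + rcis r \<theta>) \<partial>lborel"
  have "\<kappa> * \<delta> > 0" using \<kappa> \<delta> by simp
  then obtain R0 where R0: "R0 \<ge> 1" "\<And>R. R \<ge> R0 \<Longrightarrow> (\<integral>\<^sup>+r\<in>{2 * R..4 * R}. ?I r \<partial>lborel) \<le> ennreal (\<kappa> * \<delta> * R)"
    using nn_integral_annulus_potential_tendsto_0[OF w sum] by blast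
  show ?thesis
  proof (rule that[OF R0(1)])
    fix R assume R: "R \<ge> R0"
    have "\<exists>r\<in>{2 * R..4 * R}. ?I r \<le> ennreal (\<kappa> * \<delta>)"
    proof (rule ccontr)
      assume "\<not> ?thesis"
      then have ge: "ennreal (\<kappa> * \<delta>) \<le> ?I r" if "r \<in> {2 * R..4 * R}" for r
        using that by force
      have "ennreal (\<kappa> * \<delta>) * ennreal (2 * R) = (\<integral>\<^sup>+r\<in>{2 * R..4 * R}. ennreal (\<kappa> * \<delta>) \<partial>lborel)"
        using R R0(1) by (simp add: nn_integral_cmult_indicator)
      also have "\<dots> \<le> (\<integral>\<^sup>+r\<in>{2 * R..4 * R}. ?I r \<partial>lborel)"
      proof (rule nn_integral_mono)
        fix r :: real
        show "ennreal (\<kappa> * \<delta>) * indicator {2 * R..4 * R} r \<le> ?I r * indicator {2 * R..4 * R} r"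
          using ge[of r] by (cases "r \<in> {2 * R..4 * R}") auto
      qed
      also have "\<dots> \<le> ennreal (\<kappa> * \<delta> * R)" by (rule R0(2)[OF R])
      finally have "\<kappa> * \<delta> * (2 * R) \<le> \<kappa> * \<delta> * R"
        using \<kappa> \<delta> R R0(1) by (simp add: ennreal_mult[symmetric])
      then show False using \<kappa> \<delta> R R0(1) by simp
    qed
    then obtain r where r: "r \<in> {2 * R..4 * R}" "?I r \<le> ennreal (\<kappa> * \<delta>)" by blast
    note m = cauchy_potential_circle_measurable
    have "{\<theta>\<in>{0..2 * pi}. ennreal \<kappa> \<le> cauchy_potential w t (p + rcis r \<theta>)}
      \<subseteq> {\<theta>\<in>{0..2 * pi}. 1 \<le> ennreal (1 / \<kappa>) * cauchy_potential w t (p + rcis r \<theta>)}"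
    proof safe
      fix \<theta> assume "ennreal \<kappa> \<le> cauchy_potential w t (p + rcis r \<theta>)"
      then have "ennreal (1 / \<kappa>) * ennreal \<kappa> \<le> ennreal (1 / \<kappa>) * cauchy_potential w t (p + rcis r \<theta>)"
        by (rule mult_left_mono) simp
      then show "1 \<le> ennreal (1 / \<kappa>) * cauchy_potential w t (p + rcis r \<theta>)"
        using \<kappa> by (simp add: ennreal_mult[symmetric])
    qed
    then have "emeasure lborel {\<theta>\<in>{0..2 * pi}. ennreal \<kappa> \<le> cauchy_potential w t (p + rcis r \<theta>)}
      \<le> emeasure lborel {\<theta>\<in>{0..2 * pi}. 1 \<le> ennreal (1 / \<kappa>) * cauchy_potential w t (p + rcis r \<theta>)}"
      by (rule emeasure_mono) (use m in measurable)
    also have "\<dots> \<le> ennreal (1 / \<kappa>) * ?I r"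
      by (rule nn_integral_Markov_inequality) (use m in measurable)
    also have "\<dots> \<le> ennreal (1 / \<kappa>) * ennreal (\<kappa> * \<delta>)"
      by (rule mult_left_mono[OF r(2)]) simp
    also have "\<dots> = ennreal \<delta>" using \<kappa> \<delta> by (simp add: ennreal_mult[symmetric])
    finally show "\<exists>r\<in>{2 * R..4 * R}. emeasure lborel {\<theta>\<in>{0..2 * pi}. ennreal \<kappa> \<le> cauchy_potential w t (p + rcis r \<theta>)} \<le> ennreal \<delta>"
      using r(1) by blast
  qed
qed

section \<open>Entire quotients that are small off the potential\<close>

lemma entire_bounded_on_disc:
  assumes "f holomorphic_on UNIV"
  obtains K where "\<And>z. norm z \<le> r \<Longrightarrow> norm (f z) \<le> K" "K \<ge> 0"
proof -
  have "bounded (f ` cball 0 r)"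
    by (intro compact_imp_bounded compact_continuous_image continuous_on_subset[OF holomorphic_on_imp_continuous_on[OF assms]]) auto
  then obtain K where "K > 0" "\<forall>x\<in>f ` cball 0 r. norm x \<le> K" unfolding bounded_pos by blast
  then show ?thesis using that[of K] by auto
qed

text \<open>The base \<open>1 + norm z\<close> is at least 1, so constant factors in front of the
  exponential can be absorbed into \<open>C\<close>. An integral exponent makes the rescaling from R
  to 4R cost exactly \<open>4 ^ k\<close>.\<close>

definition exp_growth :: "nat \<Rightarrow> (complex \<Rightarrow> complex) \<Rightarrow> bool" where
  "exp_growth k f \<longleftrightarrow> (\<exists>C\<ge>0. \<forall>z. norm (f z) \<le> exp (C * (1 + norm z) ^ k))"

lemma exp_growthI:
  assumes C: "C \<ge> 0" and c: "c \<ge> 0" and le: "\<And>z. norm (f z) \<le> c * exp (C * (1 + norm z) ^ k)"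
  shows "exp_growth k f"
  unfolding exp_growth_def
proof (intro exI[of _ "c + C"] conjI allI)
  fix z :: complex
  have "1 \<le> (1 + norm z) ^ k" by simp
  then have "c * 1 \<le> c * (1 + norm z) ^ k" by (rule mult_left_mono) (rule c)
  then have "c \<le> exp (c * (1 + norm z) ^ k)"
    using exp_ge_add_one_self[of "c * (1 + norm z) ^ k"] by linarith
  then have "c * exp (C * (1 + norm z) ^ k) \<le> exp (c * (1 + norm z) ^ k) * exp (C * (1 + norm z) ^ k)"
    by (rule mult_right_mono) simp
  then show "norm (f z) \<le> exp ((c + C) * (1 + norm z) ^ k)"
    unfolding distrib_right exp_add by (rule order_trans[OF le])
qed (use C c in auto)

lemma exp_growth_cmult:
  assumes "exp_growth k f"
  shows "exp_growth k (\<lambda>z. a * f z)"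
proof -
  obtain C where C: "C \<ge> 0" "\<And>z. norm (f z) \<le> exp (C * (1 + norm z) ^ k)"
    using assms unfolding exp_growth_def by blast
  show ?thesis
    by (rule exp_growthI[OF C(1), of "norm a"]) (auto simp: norm_mult intro!: mult_left_mono C)
qed

lemma exp_growth_common:
  assumes "exp_growth k f" "exp_growth k g"
  obtains C where "C \<ge> 0" "\<And>z. norm (f z) \<le> exp (C * (1 + norm z) ^ k)"
    "\<And>z. norm (g z) \<le> exp (C * (1 + norm z) ^ k)"
proof -
  obtain C where C: "C \<ge> 0" "\<And>z. norm (f z) \<le> exp (C * (1 + norm z) ^ k)"
    using assms unfolding exp_growth_def by blast
  obtain D where D: "D \<ge> 0" "\<And>z. norm (g z) \<le> exp (D * (1 + norm z) ^ k)"
    using assms unfolding exp_growth_def by blast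
  have le: "exp (C * (1 + norm z) ^ k) \<le> exp (max C D * (1 + norm z) ^ k)"
    "exp (D * (1 + norm z) ^ k) \<le> exp (max C D * (1 + norm z) ^ k)" for z :: complex
    by (auto intro!: mult_right_mono)
  show ?thesis
    using that[of "max C D"] C(1) order_trans[OF C(2) le(1)] order_trans[OF D(2) le(2)] by simp
qed

lemma exp_growth_diff:
  assumes "exp_growth k f" "exp_growth k g"
  shows "exp_growth k (\<lambda>z. f z - g z)"
proof -
  obtain C where C: "C \<ge> 0" "\<And>z. norm (f z) \<le> exp (C * (1 + norm z) ^ k)"
    "\<And>z. norm (g z) \<le> exp (C * (1 + norm z) ^ k)"
    using exp_growth_common[OF assms] by blast
  show ?thesis
  proof (rule exp_growthI[OF C(1), of 2])
    show "norm (f z - g z) \<le> 2 * exp (C * (1 + norm z) ^ k)" for z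
      using norm_triangle_ineq4[of "f z" "g z"] C(2,3)[of z] by linarith
  qed simp
qed

lemma finite_order_imp_exp_growth:
  assumes A: "A holomorphic_on UNIV" and ford: "finite_order A"
  obtains k where "k \<ge> 1" "exp_growth k A"
proof -
  obtain \<rho> C where C: "\<And>z. norm (A z) \<le> C * exp (norm z powr \<rho>)"
    using ford unfolding finite_order_def by blast
  \<comment> \<open>The given order may be negative or fractional. Outside the unit disc
    \<open>powr\<close> increases with the exponent, so an integer above it works; on the disc
    itself the compactness bound \<open>K\<close> is used. The lower bound 1 is needed to absorb
    linear factors later.\<close>
  define k where "k = max 1 (nat \<lceil>\<rho>\<rceil>)"
  obtain K where K: "\<And>z. norm z \<le> 1 \<Longrightarrow> norm (A z) \<le> K" and K0: "K \<ge> 0"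
    using entire_bounded_on_disc[OF A] by blast
  have "exp_growth k A"
  proof (rule exp_growthI[of 1 "\<bar>C\<bar> + K"])
    fix z :: complex
    show "norm (A z) \<le> (\<bar>C\<bar> + K) * exp (1 * (1 + norm z) ^ k)"
    proof (cases "norm z \<le> 1")
      case True
      have "norm (A z) \<le> (\<bar>C\<bar> + K) * 1" using K[OF True] by simp
      also have "\<dots> \<le> (\<bar>C\<bar> + K) * exp (1 * (1 + norm z) ^ k)"
        using K0 by (intro mult_left_mono) auto
      finally show ?thesis .
    next
      case False
      have "\<rho> \<le> real k" unfolding k_def by linarith
      then have "norm z powr \<rho> \<le> norm z powr real k" using False by (intro powr_mono) auto
      also have "\<dots> = norm z ^ k" using False by (intro powr_realpow) (auto intro: less_trans[OF zero_less_one])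
      also have "\<dots> \<le> (1 + norm z) ^ k" by (intro power_mono) auto
      finally have *: "exp (norm z powr \<rho>) \<le> exp (1 * (1 + norm z) ^ k)" by simp
      have "norm (A z) \<le> C * exp (norm z powr \<rho>)" by (rule C)
      also have "\<dots> \<le> (\<bar>C\<bar> + K) * exp (norm z powr \<rho>)" using K0 by (intro mult_right_mono) auto
      also have "\<dots> \<le> (\<bar>C\<bar> + K) * exp (1 * (1 + norm z) ^ k)" using K0 * by (intro mult_left_mono) auto
      finally show ?thesis .
    qed
  qed (use K0 in auto)
  moreover have "k \<ge> 1" by (simp add: k_def)
  ultimately show ?thesis using that by blast
qed

section \<open>Growth of the quotient and decay under enlargement of the disc\<close>

lemma rescaled_entire:
  fixes p c :: complex
  assumes "f holomorphic_on UNIV"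
  shows "(\<lambda>w. f (p + c * w)) holomorphic_on A"
proof -
  have "(\<lambda>w. p + c * w) holomorphic_on A" by (intro holomorphic_intros)
  then show ?thesis
    using holomorphic_on_compose_gen[of "\<lambda>w. p + c * w" A f UNIV, unfolded o_def] assms by blast
qed

lemma harnack_disc:
  assumes S: "S holomorphic_on UNIV" and r: "r > 0" and z: "2 * norm (z - p) \<le> r"
  shows "2 * pi * ln (max 1 (norm (S z))) \<le> 3 * integral {0..2 * pi} (\<lambda>\<theta>. ln (max 1 (norm (S (p + rcis r \<theta>)))))"
proof -
  have "norm ((z - p) / of_real r) \<le> 1 / 2" using z r by (simp add: norm_divide field_simps)
  from ln_max_harnack[OF rescaled_entire[OF S, of p "of_real r"] this] r
  show ?thesis by (simp add: rcis_def)
qed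

lemma quotient_growth:
  assumes S: "S holomorphic_on UNIV" and B: "B holomorphic_on UNIV"
    and eq: "\<And>z. S z * B z = F z" and Bp: "B p \<noteq> 0" and C: "C \<ge> 0"
    and Fg: "\<And>z. norm (F z) \<le> exp (C * (1 + norm z) ^ k)"
    and Bg: "\<And>z. norm (B z) \<le> exp (C * (1 + norm z) ^ k)"
  obtains D where "D \<ge> 0" "\<And>R z. R \<ge> 1 \<Longrightarrow> norm (z - p) \<le> R \<Longrightarrow> ln (max 1 (norm (S z))) \<le> D * R ^ k"
proof -
  \<comment> \<open>The factor 3 is Harnack's constant. On the circle of radius 2R about
    \<open>p\<close> one has 1 + |z| \<le> (3 + |p|) R for R \<ge> 1, and the term ln |B p| comes
    from the centre in Jensen's inequality.\<close>
  define D where "D = 3 * (C * (3 + norm p) ^ k + \<bar>ln (norm (B p))\<bar>)"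
  have D0: "D \<ge> 0" unfolding D_def using C by (intro mult_nonneg_nonneg add_nonneg_nonneg) auto
  show ?thesis
  proof (rule that[OF D0])
    fix R :: real and z assume R: "R \<ge> 1" and z: "norm (z - p) \<le> R"
    define K where "K = C * (1 + (norm p + 2 * R)) ^ k"
    have exK: "exp (C * (1 + norm (p + of_real (2 * R) * w)) ^ k) \<le> exp K" if "norm w = 1" for w
    proof -
      have "norm (p + of_real (2 * R) * w) \<le> norm p + 2 * R"
        using norm_triangle_ineq[of p "of_real (2 * R) * w"] that R by (simp add: norm_mult)
      then show ?thesis
        unfolding K_def using C by (auto intro!: mult_left_mono power_mono)
    qed
    have "integral {0..2 * pi} (\<lambda>\<theta>. ln (max 1 (norm (S (p + of_real (2 * R) * cis \<theta>)))))
        \<le> 2 * pi * (K - ln (norm (B (p + of_real (2 * R) * 0))))"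
    proof (rule quotient_ln_max_mean_le[of "\<lambda>w. B (p + of_real (2 * R) * w)" 2 "\<lambda>w. S (p + of_real (2 * R) * w)"
            "\<lambda>w. F (p + of_real (2 * R) * w)"])
      fix w :: complex assume w: "norm w = 1"
      show "norm (F (p + of_real (2 * R) * w)) \<le> exp K" "norm (B (p + of_real (2 * R) * w)) \<le> exp K"
        using order_trans[OF Fg exK[OF w]] order_trans[OF Bg exK[OF w]] by auto
    qed (use rescaled_entire S B Bp eq in auto)
    then have "integral {0..2 * pi} (\<lambda>\<theta>. ln (max 1 (norm (S (p + rcis (2 * R) \<theta>)))))
        \<le> 2 * pi * (K - ln (norm (B p)))"
      by (simp only: rcis_def mult_zero_right add_0_right)
    moreover have "2 * pi * ln (max 1 (norm (S z)))
        \<le> 3 * integral {0..2 * pi} (\<lambda>\<theta>. ln (max 1 (norm (S (p + rcis (2 * R) \<theta>)))))"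
      by (rule harnack_disc[OF S]) (use R z in auto)
    ultimately have "2 * pi * ln (max 1 (norm (S z))) \<le> 3 * (2 * pi * (K - ln (norm (B p))))"
      by linarith
    also have "\<dots> = 2 * pi * (3 * (K - ln (norm (B p))))" by (rule mult.left_commute)
    finally have "ln (max 1 (norm (S z))) \<le> 3 * (K - ln (norm (B p)))"
      by (rule mult_left_le_imp_le) simp
    also have "\<dots> \<le> 3 * (K + \<bar>ln (norm (B p))\<bar>)" by simp
    also have "\<dots> \<le> D * R ^ k"
    proof -
      have "1 + (norm p + 2 * R) \<le> (3 + norm p) * R"
        using R mult_left_mono[of 1 R "norm p"] by (simp add: algebra_simps)
      then have "K \<le> C * ((3 + norm p) * R) ^ k"
        unfolding K_def using R by (intro mult_left_mono power_mono C) auto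
      moreover have "1 \<le> R ^ k" using R by simp
      then have "\<bar>ln (norm (B p))\<bar> * 1 \<le> \<bar>ln (norm (B p))\<bar> * R ^ k" by (rule mult_left_mono) simp
      ultimately have "3 * (K + \<bar>ln (norm (B p))\<bar>)
          \<le> 3 * (C * ((3 + norm p) * R) ^ k + \<bar>ln (norm (B p))\<bar> * R ^ k)" by simp
      also have "\<dots> = D * R ^ k"
        unfolding D_def power_mult_distrib by (simp add: distrib_right)
      finally show ?thesis .
    qed
    finally show "ln (max 1 (norm (S z))) \<le> D * R ^ k" .
  qed
qed

lemma bounded_off_potential_imp_bounded:
  assumes S: "S holomorphic_on UNIV"
    and D: "D \<ge> 0" "\<And>R z. R \<ge> 1 \<Longrightarrow> norm (z - p) \<le> R \<Longrightarrow> ln (max 1 (norm (S z))) \<le> D * R ^ k"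
    and w: "\<And>n. w n \<ge> 0" and sum: "summable (\<lambda>n. w n / (1 + norm (t n)))"
    and \<kappa>: "\<kappa> > 0" and small: "\<And>z. cauchy_potential w t z < ennreal \<kappa> \<Longrightarrow> norm (S z) \<le> 1"
  shows "norm (S z) \<le> 1"
proof -
  define u where "u = (\<lambda>z. ln (max 1 (norm (S z))))"
  have u0: "u z \<ge> 0" for z by (simp add: u_def)
  \<comment> \<open>Chosen so that Harnack's 3 \<delta> / (2 pi) equals 1 / (2 * 4^k). The factor
    4^k pays for evaluating the bound D R^k at radius 4R, and the remaining 2 yields geometric decay
    in the iteration.\<close>
  define \<delta> where "\<delta> = pi / (3 * 4 ^ k)"
  have "\<delta> > 0" by (simp add: \<delta>_def)
  then obtain R0 where R0: "R0 \<ge> 1" "\<And>R. R \<ge> R0 \<Longrightarrow>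
    \<exists>r\<in>{2 * R..4 * R}. emeasure lborel {\<theta>\<in>{0..2 * pi}. ennreal \<kappa> \<le> cauchy_potential w t (p + rcis r \<theta>)} \<le> ennreal \<delta>"
    using potential_small_on_circle[OF w sum \<kappa>] by blast
  have step: "u z \<le> M / (2 * 4 ^ k)"
    if R: "R \<ge> R0" and z: "norm (z - p) \<le> R" and M: "\<And>z. norm (z - p) \<le> 4 * R \<Longrightarrow> u z \<le> M" for R z M
  proof -
    have M0: "M \<ge> 0" using M[of p] u0[of p] R R0(1) by simp
    obtain r where r: "r \<in> {2 * R..4 * R}"
      "emeasure lborel {\<theta>\<in>{0..2 * pi}. ennreal \<kappa> \<le> cauchy_potential w t (p + rcis r \<theta>)} \<le> ennreal \<delta>"
      using R0(2)[OF R] by blast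
    have r0: "r > 0" using r(1) R R0(1) by auto
    define E where "E = {\<theta>\<in>{0..2 * pi}. ennreal \<kappa> \<le> cauchy_potential w t (p + rcis r \<theta>)}"
    have [measurable]: "(\<lambda>\<theta>. cauchy_potential w t (p + rcis r \<theta>)) \<in> borel_measurable borel"
      by (rule cauchy_potential_circle_measurable)
    have E: "E \<in> sets lborel" unfolding E_def by measurable
    have Ef: "emeasure lborel E < \<infinity>" using r(2) unfolding E_def[symmetric] by (simp add: le_less_trans)
    have mE: "measure lborel E \<le> \<delta>"
      using r(2) \<open>\<delta> > 0\<close> unfolding E_def[symmetric] measure_def by (simp add: enn2real_leI)
    have "((\<lambda>x::real. M * 1) has_integral (M * measure lborel E)) E"
      by (intro has_integral_mult_right has_integral_measure_lborel) (use E Ef in auto)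
    then have "((\<lambda>x. if x \<in> E then M else 0) has_integral (M * measure lborel E)) {0..2 * pi}"
      by (subst has_integral_restrict) (auto simp: E_def)
    moreover have "continuous_on {0..2 * pi} (\<lambda>\<theta>. S (p + rcis r \<theta>))"
      unfolding rcis_def
      by (rule continuous_on_compose2[OF holomorphic_on_imp_continuous_on[OF S]])
         (auto intro!: continuous_intros)
    then have "continuous_on {0..2 * pi} (\<lambda>\<theta>. u (p + rcis r \<theta>))"
      unfolding u_def by (intro continuous_intros) auto
    then have "((\<lambda>\<theta>. u (p + rcis r \<theta>)) has_integral integral {0..2 * pi} (\<lambda>\<theta>. u (p + rcis r \<theta>))) {0..2 * pi}"
      by (intro integrable_integral integrable_continuous_real)
    \<comment> \<open>Off \<open>E\<close> the potential is below \<kappa>, so |S| \<le> 1 and log+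
      |S| vanishes. On \<open>E\<close> only the supremum over the disc of radius 4R, which contains
      the circle, is available.\<close>
    moreover have "u (p + rcis r \<theta>) \<le> (if \<theta> \<in> E then M else 0)" if "\<theta> \<in> {0..2 * pi}" for \<theta>
    proof (cases "\<theta> \<in> E")
      case True
      then show ?thesis using M[of "p + rcis r \<theta>"] r(1) r0 by simp
    next
      case False
      then have "norm (S (p + rcis r \<theta>)) \<le> 1" using that by (intro small) (auto simp: E_def not_le)
      then show ?thesis using False by (simp add: u_def)
    qed
    ultimately have "integral {0..2 * pi} (\<lambda>\<theta>. u (p + rcis r \<theta>)) \<le> M * measure lborel E"
      by (meson has_integral_le)
    also have "\<dots> \<le> M * \<delta>" by (rule mult_left_mono[OF mE M0])
    finally have "3 * integral {0..2 * pi} (\<lambda>\<theta>. u (p + rcis r \<theta>)) \<le> 3 * (M * \<delta>)" by simp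
    moreover have "2 * pi * u z \<le> 3 * integral {0..2 * pi} (\<lambda>\<theta>. u (p + rcis r \<theta>))"
      unfolding u_def by (rule harnack_disc[OF S r0]) (use z r(1) in auto)
    ultimately have "2 * pi * u z \<le> 3 * (M * \<delta>)" by linarith
    also have "3 * (M * \<delta>) = 2 * pi * (M / (2 * 4 ^ k))" by (simp add: \<delta>_def)
    finally show ?thesis by (rule mult_left_le_imp_le) simp
  qed
  have iter: "u z \<le> D * R ^ k / 2 ^ j" if "R \<ge> R0" "norm (z - p) \<le> R" for j R z
    using that
  proof (induction j arbitrary: R z)
    case 0
    then show ?case using D(2)[of R z] R0(1) by (simp add: u_def)
  next
    case (Suc j)
    have "u z \<le> (D * (4 * R) ^ k / 2 ^ j) / (2 * 4 ^ k)"
      by (rule step[OF Suc.prems], rule Suc.IH) (use Suc.prems R0(1) in auto)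
    also have "\<dots> = D * R ^ k / 2 ^ Suc j" by (simp add: power_mult_distrib)
    finally show ?case .
  qed
  define R where "R = max R0 (norm (z - p))"
  have "(\<lambda>j. D * R ^ k / 2 ^ j) \<longlonglongrightarrow> 0"
    by (rule LIMSEQ_divide_realpow_zero) simp
  then have "u z \<le> 0"
    by (rule LIMSEQ_le_const) (use iter[of R z] in \<open>auto simp: R_def\<close>)
  then show ?thesis by (simp add: u_def)
qed

lemma entire_quotient_small_off_potential_eq_0:
  assumes S: "S holomorphic_on UNIV" and B: "B holomorphic_on UNIV"
    and eq: "\<And>z. S z * B z = F z" and Bp: "B p \<noteq> 0"
    and Fg: "exp_growth k F" and Bg: "exp_growth k B"
    and w: "\<And>n. w n \<ge> 0" and sum: "summable (\<lambda>n. w n / (1 + norm (t n)))"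
    and small: "\<And>\<eta>. \<eta> > 0 \<Longrightarrow> \<exists>\<kappa>>0. \<forall>z. cauchy_potential w t z < ennreal \<kappa> \<longrightarrow> norm (S z) \<le> \<eta>"
  shows "S z = 0"
proof -
  obtain C where C: "C \<ge> 0"
    and FC: "\<And>z. norm (F z) \<le> exp (C * (1 + norm z) ^ k)"
    and BC: "\<And>z. norm (B z) \<le> exp (C * (1 + norm z) ^ k)"
    using exp_growth_common[OF Fg Bg] by blast
  have "norm (S z) \<le> \<eta>" if \<eta>: "0 < \<eta>" "\<eta> \<le> 1" for \<eta>
  proof -
    \<comment> \<open>Since log+ only sees values above 1, S is divided by \<eta>. The compensating
      factor goes into \<open>B\<close>, so \<open>F\<close> and its bound stay as they are, and
      \<eta> \<le> 1 keeps the bound on \<open>B\<close>.\<close>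
    let ?S = "\<lambda>z. S z / of_real \<eta>" and ?B = "\<lambda>z. of_real \<eta> * B z"
    have S': "?S holomorphic_on UNIV" and B': "?B holomorphic_on UNIV"
      using S B \<eta> by (auto intro!: holomorphic_intros)
    have Bg': "norm (?B z) \<le> exp (C * (1 + norm z) ^ k)" for z
    proof -
      have "norm (?B z) \<le> 1 * norm (B z)" using \<eta> unfolding norm_mult by (intro mult_right_mono) auto
      then show ?thesis using BC[of z] by simp
    qed
    obtain D where D: "D \<ge> 0" "\<And>R z. R \<ge> 1 \<Longrightarrow> norm (z - p) \<le> R \<Longrightarrow> ln (max 1 (norm (?S z))) \<le> D * R ^ k"
      by (rule quotient_growth[OF S' B' _ _ C FC Bg', of p]) (use eq Bp \<eta> in auto)
    obtain \<kappa> where \<kappa>: "\<kappa> > 0" "\<And>z. cauchy_potential w t z < ennreal \<kappa> \<Longrightarrow> norm (S z) \<le> \<eta>"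
      using small[OF \<eta>(1)] by blast
    have "norm (?S z) \<le> 1"
      by (rule bounded_off_potential_imp_bounded[OF S' D w sum \<kappa>(1)])
         (use \<kappa>(2) \<eta> in \<open>auto simp: norm_divide\<close>)
    then show ?thesis using \<eta> by (simp add: norm_divide)
  qed
  note le = this
  show ?thesis
  proof (rule ccontr)
    assume "S z \<noteq> 0"
    then have "norm (S z) > 0" by simp
    then show False using le[of "min 1 (norm (S z) / 2)"] by simp
  qed
qed

section \<open>Cauchy--de Branges spaces\<close>

text \<open>Reading the vanishing condition at the order m of a zero of \<open>F\<close> shows that
  the order of \<open>B\<close> there is at most m, since otherwise all derivatives of
  \<open>B\<close> up to m would vanish while the m-th derivative of \<open>F\<close> does not.
  Hence all singularities of F / B are removable.\<close>

lemma entire_quotient_exists: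
  assumes F: "F holomorphic_on UNIV" and B: "B holomorphic_on UNIV" and Bp: "B p \<noteq> 0"
    and van: "vanishes_on_zeros F B"
  obtains S where "S holomorphic_on UNIV" "\<And>z. S z * B z = F z"
\<comment> \<open>The zero function has no order at any point, so it is treated apart.\<close>
proof (cases "\<forall>z. F z = 0")
  case True
  then show ?thesis using that[of "\<lambda>_. 0"] by auto
next
  case False
  then obtain q where q: "F q \<noteq> 0" by blast
  have factor: "\<exists>n g r. 0 < r \<and> g holomorphic_on ball z r \<and> (\<forall>w\<in>ball z r. f w = (w - z) ^ n * g w)
      \<and> (\<forall>w\<in>ball z r. g w \<noteq> 0) \<and> (deriv ^^ n) f z \<noteq> 0 \<and> (\<forall>i<n. (deriv ^^ i) f z = 0)"
    if f: "f holomorphic_on UNIV" "f q \<noteq> 0" for f q z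
  proof -
    have "\<exists>n. (deriv ^^ n) f z \<noteq> 0"
      using holomorphic_fun_eq_0_on_connected[OF f(1) open_UNIV connected_UNIV, of z q] f(2) by auto
    define n where "n = (LEAST n. (deriv ^^ n) f z \<noteq> 0)"
    have n: "(deriv ^^ n) f z \<noteq> 0"
      unfolding n_def by (rule LeastI_ex) fact
    have least: "(deriv ^^ i) f z = 0" if "i < n" for i
      using not_less_Least[of i "\<lambda>n. (deriv ^^ n) f z \<noteq> 0"] that by (auto simp: n_def)
    show ?thesis
    proof (cases "n = 0")
      case True
      have "continuous_on UNIV f" using f(1) by (rule holomorphic_on_imp_continuous_on)
      then obtain e where "e > 0" "\<And>y. dist y z < e \<Longrightarrow> f y \<noteq> 0"
        using n True continuous_on_open_avoid[of UNIV f z 0] by (auto simp: dist_commute)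
      then show ?thesis using True n f(1)
        by (intro exI[of _ 0] exI[of _ f] exI[of _ e]) (auto simp: dist_commute intro: holomorphic_on_subset)
    next
      case n0: False
      then have "f z = 0" using least[of 0] by simp
      have pos: "0 < n" using n0 by simp
      show ?thesis
      proof (rule holomorphic_factor_order_of_zero[OF f(1) open_UNIV UNIV_I pos n])
        show "(deriv ^^ i) f z = 0" if "0 < i" "i < n" for i using least that by blast
        fix g r
        assume "0 < r" "g holomorphic_on ball z r"
          "\<And>w. w \<in> ball z r \<Longrightarrow> f w - f z = (w - z) ^ n * g w" "\<And>w. w \<in> ball z r \<Longrightarrow> g w \<noteq> 0"
        then show ?thesis
          using n least \<open>f z = 0\<close> by (intro exI[of _ n] exI[of _ g] exI[of _ r]) auto
      qed
    qed
  qed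
  \<comment> \<open>The value at a zero of \<open>B\<close> is fixed as a limit, so the local
    quotients all agree with one globally defined function and need not be glued.\<close>
  define S where "S = (\<lambda>z. if B z \<noteq> 0 then F z / B z else Lim (at z) (\<lambda>w. F w / B w))"
  have loc: "\<exists>s r. r > 0 \<and> s holomorphic_on ball z r \<and> (\<forall>w\<in>ball z r. s w = S w \<and> S w * B w = F w)" for z
  proof -
    obtain n b r where b: "0 < r" "b holomorphic_on ball z r" "\<And>w. w \<in> ball z r \<Longrightarrow> B w = (w - z) ^ n * b w"
      "\<And>w. w \<in> ball z r \<Longrightarrow> b w \<noteq> 0" "(deriv ^^ n) B z \<noteq> 0" "\<And>i. i < n \<Longrightarrow> (deriv ^^ i) B z = 0"
      using factor[OF B Bp, of z] by blast
    obtain m f r' where f: "0 < r'" "f holomorphic_on ball z r'" "\<And>w. w \<in> ball z r' \<Longrightarrow> F w = (w - z) ^ m * f w"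
      "(deriv ^^ m) F z \<noteq> 0"
      using factor[OF F q, of z] by blast
    have nm: "n \<le> m"
    proof (rule ccontr)
      assume "\<not> n \<le> m"
      then have "\<forall>j\<le>m. (deriv ^^ j) B z = 0" using b(6) by auto
      then show False using van f(4) unfolding vanishes_on_zeros_def by blast
    qed
    define \<rho> where "\<rho> = min r r'"
    define s where "s = (\<lambda>w. (w - z) ^ (m - n) * f w / b w)"
    have \<rho>: "\<rho> > 0" "ball z \<rho> \<subseteq> ball z r" "ball z \<rho> \<subseteq> ball z r'"
      using b(1) f(1) by (auto simp: \<rho>_def)
    have hol: "s holomorphic_on ball z \<rho>"
      unfolding s_def using \<rho> b(2,4) f(2)
      by (intro holomorphic_intros) (auto intro: holomorphic_on_subset)
    have sB: "s w * B w = F w" if "w \<in> ball z \<rho>" for w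
    proof -
      have w: "w \<in> ball z r" "w \<in> ball z r'" using that \<rho> by blast+
      have "F w = (w - z) ^ (m - n) * (w - z) ^ n * f w"
        using f(3)[OF w(2)] nm by (simp flip: power_add)
      then show ?thesis using b(3,4)[OF w(1)] by (simp add: s_def)
    qed
    have BZ: "B w \<noteq> 0" if "w \<in> ball z \<rho>" "w \<noteq> z" for w
    proof -
      have w: "w \<in> ball z r" using that \<rho> by blast
      show ?thesis using b(3,4)[OF w] that by simp
    qed
    have sS: "s w = S w" if "w \<in> ball z \<rho>" for w
    proof (cases "B w = 0")
      case False
      then show ?thesis using sB[OF that] by (simp add: S_def field_simps)
    next
      case True
      then have wz: "w = z" using BZ that by blast
      have "(s \<longlongrightarrow> s z) (at z)"
        using holomorphic_on_imp_continuous_on[OF hol] \<rho>(1) by (simp add: continuous_on_eq_continuous_at isCont_def)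
      then have "((\<lambda>w. F w / B w) \<longlongrightarrow> s z) (at z)"
      proof (rule Lim_transform_within_open[of _ _ _ _ "ball z \<rho>"])
        fix x assume "x \<in> ball z \<rho>" "x \<noteq> z"
        then show "s x = F x / B x" using sB[of x] BZ[of x] by (simp add: field_simps)
      qed (use \<rho> in auto)
      then have "Lim (at z) (\<lambda>w. F w / B w) = s z" by (intro tendsto_Lim) auto
      then show ?thesis using True wz by (simp add: S_def)
    qed
    show ?thesis using \<rho>(1) hol sS sB by (intro exI[of _ s] exI[of _ \<rho>]) auto
  qed
  show ?thesis
  proof (rule that)
    show "S z * B z = F z" for z using loc[of z] by (metis centre_in_ball)
    show "S holomorphic_on UNIV"
    proof (subst holomorphic_on_open[OF open_UNIV], intro ballI)
      fix z
      obtain s r where s: "r > 0" "s holomorphic_on ball z r" "\<And>w. w \<in> ball z r \<Longrightarrow> s w = S w"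
        using loc[of z] by blast
      then have "(s has_field_derivative deriv s z) (at z)"
        by (intro holomorphic_derivI[OF s(2)]) auto
      then have "(S has_field_derivative deriv s z) (at z)"
        using s by (intro has_field_derivative_transform_within_open[of s _ z "ball z r" S]) auto
      then show "\<exists>f'. (S has_field_derivative f') (at z)" by blast
    qed
  qed
qed

section \<open>Series of the functions \<open>cdb_kernel A t n\<close>\<close>

locale cdb =
  fixes t :: "nat \<Rightarrow> complex" and A :: "complex \<Rightarrow> complex"
  assumes inj_t: "inj t" and A: "A holomorphic_on UNIV"
    and zeros: "\<And>z. A z = 0 \<longleftrightarrow> z \<in> range t"
begin

lemma kernel_holomorphic: "cdb_kernel A t n holomorphic_on UNIV"
  by (rule pole_theorem_open_0[OF A open_UNIV, of "t n"]) (auto simp: cdb_kernel_def zeros)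

lemma kernel_mult: "z * cdb_kernel A t n z = A z + t n * cdb_kernel A t n z"
proof (cases "z = t n")
  case True
  then have "A z = 0" using zeros by blast
  then show ?thesis using True by simp
next
  case False
  then have "(z - t n) * cdb_kernel A t n z = A z" by (simp add: cdb_kernel_def)
  then show ?thesis by (simp add: algebra_simps)
qed

lemma norm_kernel_le:
  assumes K: "\<And>\<zeta>. norm \<zeta> \<le> norm z + 2 \<Longrightarrow> norm (A \<zeta>) \<le> K"
  shows "norm (cdb_kernel A t n z) \<le> K * (2 + norm z) / (1 + norm (t n))"
proof -
  have K0: "K \<ge> 0" using K[of z] by (meson norm_ge_zero order_trans le_add_same_cancel1 zero_le_numeral)
  have pos: "1 + norm (t n) > 0" by (simp add: add_pos_nonneg)
  have tn: "norm (t n) \<le> norm z + norm (z - t n)"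
    using norm_triangle_ineq4[of z "z - t n"] by simp
  show ?thesis
  proof (cases "norm (z - t n) \<ge> 1")
    case True
    have "1 + norm (t n) \<le> 2 + norm z - 1 + norm (z - t n)" using tn by simp
    also have "\<dots> \<le> (2 + norm z) * norm (z - t n)"
      using mult_left_mono[OF True, of "1 + norm z"] by (simp add: algebra_simps)
    finally have "1 * (1 + norm (t n)) \<le> (2 + norm z) * norm (z - t n)" by simp
    then have "1 / norm (z - t n) \<le> (2 + norm z) / (1 + norm (t n))"
      using True pos by (simp only: pos_divide_le_eq times_divide_eq_left pos_le_divide_eq less_le_trans[OF zero_less_one])
    then have "norm (A z) * (1 / norm (z - t n)) \<le> K * ((2 + norm z) / (1 + norm (t n)))"
      using K[of z] K0 by (intro mult_mono) auto
    moreover have "cdb_kernel A t n z = A z / (z - t n)" using True by (auto simp: cdb_kernel_def)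
    ultimately show ?thesis by (simp add: norm_divide)
  next
    case False
    have "norm (cdb_kernel A t n z) \<le> K"
    proof (rule maximum_modulus_frontier[of "cdb_kernel A t n" "cball (t n) 1"])
      show "cdb_kernel A t n holomorphic_on interior (cball (t n) 1)"
        using kernel_holomorphic by (rule holomorphic_on_subset) simp
      show "continuous_on (closure (cball (t n) 1)) (cdb_kernel A t n)"
        by (rule continuous_on_subset[OF holomorphic_on_imp_continuous_on[OF kernel_holomorphic]]) simp
      show "z \<in> cball (t n) 1" using False by (simp add: dist_norm norm_minus_commute)
      fix \<zeta> assume "\<zeta> \<in> frontier (cball (t n) 1)"
      then have d: "norm (\<zeta> - t n) = 1" by (simp add: dist_norm norm_minus_commute)
      then have "\<zeta> \<noteq> t n" by auto
      moreover have "norm \<zeta> \<le> norm z + 2"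
        using norm_triangle_ineq[of "\<zeta> - t n" "t n"] d tn False by simp
      ultimately show "norm (cdb_kernel A t n \<zeta>) \<le> K"
        using K[of \<zeta>] d by (simp add: cdb_kernel_def norm_divide)
    qed simp
    also have "K \<le> K * ((2 + norm z) / (1 + norm (t n)))"
    proof -
      have "1 \<le> (2 + norm z) / (1 + norm (t n))" using pos tn False by (simp add: pos_le_divide_eq)
      then show ?thesis using mult_left_mono[of 1 "(2 + norm z) / (1 + norm (t n))" K] K0 by simp
    qed
    finally show ?thesis by simp
  qed
qed

lemma kernel_at_node: "cdb_kernel A t n (t m) = (if n = m then deriv A (t m) else 0)"
proof (cases "n = m")
  case False
  have "A (t m) = 0" using zeros by blast
  then show ?thesis using False inj_t by (auto simp: cdb_kernel_def dest: injD)
qed (simp add: cdb_kernel_def)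

lemma kernel_sum_at_node: "(\<Sum>n. d n * cdb_kernel A t n (t m)) = d m * deriv A (t m)"
  by (subst suminf_finite[of "{m}"]) (auto simp: kernel_at_node)

context
  fixes d :: "nat \<Rightarrow> complex"
  assumes sumd: "summable (\<lambda>n. norm (d n) / (1 + norm (t n)))"
begin

lemma norm_kernel_term_le:
  assumes K: "\<And>\<zeta>. norm \<zeta> \<le> norm z + 2 \<Longrightarrow> norm (A \<zeta>) \<le> K"
  shows "norm (d n * cdb_kernel A t n z) \<le> K * (2 + norm z) * (norm (d n) / (1 + norm (t n)))"
proof -
  have "norm (d n) * norm (cdb_kernel A t n z) \<le> norm (d n) * (K * (2 + norm z) / (1 + norm (t n)))"
    by (intro mult_left_mono norm_kernel_le K) auto
  then show ?thesis by (simp add: norm_mult mult_ac)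
qed

lemma kernel_sum_abs_summable: "summable (\<lambda>n. norm (d n * cdb_kernel A t n z))"
proof -
  obtain K where K: "\<And>\<zeta>. norm \<zeta> \<le> norm z + 2 \<Longrightarrow> norm (A \<zeta>) \<le> K" using entire_bounded_on_disc[OF A] by blast
  show ?thesis
    by (rule summable_comparison_test[OF _ summable_mult[OF sumd]])
       (use norm_kernel_term_le[OF K] in auto)
qed

lemma kernel_sum_summable: "summable (\<lambda>n. d n * cdb_kernel A t n z)"
  by (rule summable_norm_cancel[OF kernel_sum_abs_summable])

lemma kernel_sum_holomorphic: "(\<lambda>z. \<Sum>n. d n * cdb_kernel A t n z) holomorphic_on UNIV"
proof (rule holomorphic_uniform_sequence[OF open_UNIV, of "\<lambda>N z. \<Sum>n<N. d n * cdb_kernel A t n z"])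
  show "(\<lambda>z. \<Sum>n<N. d n * cdb_kernel A t n z) holomorphic_on UNIV" for N
    by (intro holomorphic_intros kernel_holomorphic)
  fix z :: complex
  \<comment> \<open>The radius \<open>norm z + 3\<close> allows 1 for moving from \<open>z\<close>
    to \<open>y\<close> and 2 for the kernel estimate at \<open>y\<close>.\<close>
  obtain K where K: "\<And>\<zeta>. norm \<zeta> \<le> norm z + 3 \<Longrightarrow> norm (A \<zeta>) \<le> K" "K \<ge> 0" using entire_bounded_on_disc[OF A] by blast
  have "uniform_limit (cball z 1) (\<lambda>N z. \<Sum>n<N. d n * cdb_kernel A t n z) (\<lambda>z. \<Sum>n. d n * cdb_kernel A t n z) sequentially"
  proof (rule Weierstrass_m_test)
    fix n y assume "y \<in> cball z 1"
    then have y: "norm y \<le> norm z + 1"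
      using norm_triangle_ineq[of z "y - z"] by (simp add: dist_norm norm_minus_commute)
    have "norm (d n * cdb_kernel A t n y) \<le> K * (2 + norm y) * (norm (d n) / (1 + norm (t n)))"
      by (rule norm_kernel_term_le) (use y K in auto)
    also have "\<dots> \<le> K * (3 + norm z) * (norm (d n) / (1 + norm (t n)))"
      using y K(2) by (intro mult_right_mono mult_left_mono) auto
    finally show "norm (d n * cdb_kernel A t n y) \<le> K * (3 + norm z) * (norm (d n) / (1 + norm (t n)))" .
  qed (rule summable_mult[OF sumd])
  then show "\<exists>e>0. cball z e \<subseteq> UNIV \<and> uniform_limit (cball z e) (\<lambda>N z. \<Sum>n<N. d n * cdb_kernel A t n z) (\<lambda>z. \<Sum>n. d n * cdb_kernel A t n z) sequentially"
    by (intro exI[of _ 1]) auto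
qed

lemma kernel_sum_exp_growth:
  assumes k: "k \<ge> 1" and Ag: "exp_growth k A"
  shows "exp_growth k (\<lambda>z. \<Sum>n. d n * cdb_kernel A t n z)"
proof -
  obtain C where C: "C \<ge> 0" "\<And>z. norm (A z) \<le> exp (C * (1 + norm z) ^ k)"
    using Ag unfolding exp_growth_def by blast
  define D where "D = (\<Sum>n. norm (d n) / (1 + norm (t n)))"
  have D0: "D \<ge> 0" unfolding D_def by (rule suminf_nonneg[OF sumd]) simp
  \<comment> \<open>The factor \<open>3 ^ k\<close> comes from 1 + |\<zeta>| \<le> 3 (1 + |z|) when
    |\<zeta>| \<le> |z| + 2; the added 2 absorbs the linear factor \<open>2 + norm z\<close>, which
    uses \<open>k \<ge> 1\<close>.\<close>
  show ?thesis
  proof (rule exp_growthI[of "C * 3 ^ k + 2" D])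
    fix z :: complex
    let ?x = "1 + norm z"
    let ?K = "exp (C * (3 * ?x) ^ k)"
    have K: "norm (A \<zeta>) \<le> ?K" if "norm \<zeta> \<le> norm z + 2" for \<zeta>
    proof -
      have "1 + norm \<zeta> \<le> 3 * ?x" using that norm_ge_zero[of z] unfolding distrib_left by linarith
      then have "C * (1 + norm \<zeta>) ^ k \<le> C * (3 * ?x) ^ k"
        by (intro mult_left_mono power_mono C(1)) (auto intro: add_nonneg_nonneg)
      then show ?thesis using C(2)[of \<zeta>] by (meson exp_le_cancel_iff order_trans)
    qed
    have x: "?x \<le> ?x ^ k" using power_increasing[OF k, of ?x] by simp
    have "norm (\<Sum>n. d n * cdb_kernel A t n z) \<le> (\<Sum>n. ?K * (2 + norm z) * (norm (d n) / (1 + norm (t n))))"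
      by (rule order_trans[OF summable_norm[OF kernel_sum_abs_summable]])
         (rule suminf_le[OF norm_kernel_term_le[OF K] kernel_sum_abs_summable summable_mult[OF sumd]])
    also have "\<dots> = ?K * (2 + norm z) * D"
      unfolding D_def by (rule suminf_mult[OF sumd])
    also have "\<dots> \<le> ?K * exp (2 * ?x ^ k) * D"
    proof (intro mult_right_mono mult_left_mono D0)
      have "2 + norm z \<le> 1 + 2 * ?x" by simp
      also have "\<dots> \<le> 1 + 2 * ?x ^ k" using x by simp
      also have "\<dots> \<le> exp (2 * ?x ^ k)" by (rule exp_ge_add_one_self)
      finally show "2 + norm z \<le> exp (2 * ?x ^ k)" .
    qed simp
    also have "\<dots> = D * exp ((C * 3 ^ k + 2) * ?x ^ k)"
      unfolding power_mult_distrib distrib_right exp_add by simp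
    finally show "norm (\<Sum>n. d n * cdb_kernel A t n z) \<le> D * exp ((C * 3 ^ k + 2) * ?x ^ k)" .
  qed (use C D0 in auto)
qed

text \<open>Strict positivity of \<open>w\<close> makes the potential infinite at every
  \<open>t n\<close>, so a finite value already excludes the zeros of \<open>A\<close>; elsewhere
  the kernel is the plain quotient. Requiring only \<open>norm (d n) \<le> w n\<close> lets one
  weight control two series at once.\<close>

lemma kernel_sum_le_potential:
  assumes w: "\<And>n. w n > 0" "\<And>n. norm (d n) \<le> w n" and \<kappa>: "cauchy_potential w t z < ennreal \<kappa>"
  shows "A z \<noteq> 0" and "norm (\<Sum>n. d n * cdb_kernel A t n z) \<le> \<kappa> * norm (A z)"
proof -
  have fin: "cauchy_potential w t z \<noteq> top" using \<kappa> by (metis ennreal_less_top not_less_iff_gr_or_eq order_less_trans)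
  have zt: "z \<noteq> t n" for n
  proof
    assume "z = t n"
    then have "ennreal (w n) * inverse (ennreal (norm (z - t n))) = top"
      using w(1)[of n] by (simp add: ennreal_mult_top)
    moreover have "ennreal (w n) * inverse (ennreal (norm (z - t n))) \<le> cauchy_potential w t z"
      unfolding cauchy_potential_def using sum_le_suminf[of "\<lambda>n. ennreal (w n) * inverse (ennreal (norm (z - t n)))" "{n}"] by simp
    ultimately show False using fin by (simp add: top_unique)
  qed
  then show A0: "A z \<noteq> 0" using zeros by blast
  have pot: "cauchy_potential w t z = (\<Sum>n. ennreal (w n / norm (z - t n)))"
    unfolding cauchy_potential_def
    using zt w(1) by (simp add: inverse_ennreal ennreal_mult'[symmetric] less_imp_le divide_inverse)
  have nn: "0 \<le> w n / norm (z - t n)" for n using w(1)[of n] by simp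
  have summ: "summable (\<lambda>n. w n / norm (z - t n))"
    by (rule summable_suminf_not_top[OF nn]) (use fin pot in simp)
  have "(\<Sum>n. w n / norm (z - t n)) < \<kappa>"
    using \<kappa> unfolding pot suminf_ennreal2[OF nn summ]
    by (metis ennreal_less_iff suminf_nonneg[OF summ nn])
  moreover have "norm (\<Sum>n. d n * cdb_kernel A t n z) \<le> (\<Sum>n. norm (A z) * (w n / norm (z - t n)))"
  proof (rule order_trans[OF summable_norm[OF kernel_sum_abs_summable]],
      rule suminf_le[OF _ kernel_sum_abs_summable summable_mult[OF summ]])
    show "norm (d n * cdb_kernel A t n z) \<le> norm (A z) * (w n / norm (z - t n))" for n
      using mult_right_mono[OF w(2)[of n], of "norm (A z) / norm (z - t n)"] zt[of n]
      by (simp add: cdb_kernel_def norm_mult norm_divide mult_ac)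
  qed
  ultimately show "norm (\<Sum>n. d n * cdb_kernel A t n z) \<le> \<kappa> * norm (A z)"
    unfolding suminf_mult[OF summ] mult.commute[of \<kappa>]
    by (meson less_imp_le mult_left_mono norm_ge_zero order_trans)
qed

end

text \<open>At infinity this isolates the leading term of z F(z) / A(z).\<close>

lemma kernel_sum_mult:
  assumes d: "summable (\<lambda>n. norm (d n))"
  shows "z * (\<Sum>n. d n * cdb_kernel A t n z) = A z * (\<Sum>n. d n) + (\<Sum>n. d n * t n * cdb_kernel A t n z)"
proof -
  have le: "norm (d n) / (1 + norm (t n)) \<le> norm (d n)" for n
    by (simp add: divide_le_eq add_pos_nonneg mult_le_cancel_left1)
  have s: "summable (\<lambda>n. norm (d n) / (1 + norm (t n)))"
    by (rule summable_comparison_test[OF _ d]) (use le in auto)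
  have "norm (d n * t n) / (1 + norm (t n)) \<le> norm (d n)" for n
    by (simp add: norm_mult divide_le_eq add_pos_nonneg mult_left_mono)
  then have st: "summable (\<lambda>n. norm (d n * t n) / (1 + norm (t n)))"
    by (intro summable_comparison_test[OF _ d]) auto
  have "z * (\<Sum>n. d n * cdb_kernel A t n z) = (\<Sum>n. z * (d n * cdb_kernel A t n z))"
    by (rule suminf_mult[OF kernel_sum_summable[OF s], symmetric])
  also have "\<dots> = (\<Sum>n. A z * d n + d n * t n * cdb_kernel A t n z)"
  proof (rule suminf_cong)
    fix n
    have "z * (d n * cdb_kernel A t n z) = d n * (z * cdb_kernel A t n z)" by (rule mult.left_commute)
    then show "z * (d n * cdb_kernel A t n z) = A z * d n + d n * t n * cdb_kernel A t n z"
      unfolding kernel_mult by (simp add: algebra_simps)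
  qed
  also have "\<dots> = A z * (\<Sum>n. d n) + (\<Sum>n. d n * t n * cdb_kernel A t n z)"
    using summable_norm_cancel[OF d]
    by (subst suminf_add[symmetric]) (auto intro!: summable_mult kernel_sum_summable[OF st] simp: suminf_mult)
  finally show ?thesis .
qed

end

lemma vanishes_on_zeros_uminus:
  assumes "G holomorphic_on UNIV"
  shows "vanishes_on_zeros G (\<lambda>z. - G z)"
proof -
  have "(deriv ^^ j) (\<lambda>z. - G z) z = - (deriv ^^ j) G z" for j z
    by (rule higher_deriv_uminus[OF assms]) auto
  then show ?thesis unfolding vanishes_on_zeros_def by auto
qed

text \<open>A weak form of Cauchy-Schwarz, x y \<le> x^2 + y^2 termwise. It is used with
  \<open>b n = 1 / (1 + norm (t n))\<close> for arbitrary elements of the space, and with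
  \<open>b n = 1\<close> when \<mu> is summable.\<close>

lemma summable_cmod_mult_sqrt:
  fixes c :: "nat \<Rightarrow> complex"
  assumes c: "summable (\<lambda>n. (norm (c n))\<^sup>2)" and \<mu>: "\<And>n. \<mu> n \<ge> 0"
    and b: "\<And>n. b n \<ge> 0" and s: "summable (\<lambda>n. \<mu> n * (b n)\<^sup>2)"
  shows "summable (\<lambda>n. norm (c n * of_real (sqrt (\<mu> n))) * b n)"
proof (rule summable_comparison_test[OF _ summable_add[OF c s]], intro exI allI impI)
  fix n
  have "0 \<le> (norm (c n) - sqrt (\<mu> n) * b n)\<^sup>2" by simp
  also have "\<dots> = (norm (c n))\<^sup>2 + \<mu> n * (b n)\<^sup>2 - 2 * (norm (c n) * sqrt (\<mu> n) * b n)"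
    using \<mu>[of n] by (simp add: power2_diff power_mult_distrib)
  finally have "2 * (norm (c n) * sqrt (\<mu> n) * b n) \<le> (norm (c n))\<^sup>2 + \<mu> n * (b n)\<^sup>2" by simp
  moreover have "0 \<le> norm (c n) * sqrt (\<mu> n) * b n" using \<mu> b by simp
  ultimately have "norm (c n) * sqrt (\<mu> n) * b n \<le> (norm (c n))\<^sup>2 + \<mu> n * (b n)\<^sup>2" by linarith
  then show "norm (norm (c n * of_real (sqrt (\<mu> n))) * b n) \<le> (norm (c n))\<^sup>2 + \<mu> n * (b n)\<^sup>2"
    using \<mu>[of n] b[of n] by (simp add: norm_mult)
qed

section \<open>The functions \<open>cdb_B\<close> and the elements of the space\<close>

locale cdb_measure = cdb +
  fixes \<mu> :: "nat \<Rightarrow> real"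
  assumes \<mu>_pos: "\<And>n. \<mu> n > 0" and \<mu>_conv: "summable (\<lambda>n. \<mu> n / (1 + norm (t n)))"
    and \<mu>_sum: "summable (\<lambda>n. \<mu> n / ((norm (t n))\<^sup>2 + 1))"
    and deriv_A: "\<And>n. deriv A (t n) \<noteq> 0" and ford: "finite_order A"
begin

lemma cdb_B_eq: "cdb_B t \<mu> A \<gamma> = (\<lambda>z. \<gamma> * A z - (\<Sum>n. of_real (\<mu> n) * cdb_kernel A t n z))"
  by (simp add: cdb_B_def fun_eq_iff)

lemma \<mu>_conv': "summable (\<lambda>n. norm (complex_of_real (\<mu> n)) / (1 + norm (t n)))"
  using \<mu>_conv \<mu>_pos by (simp add: less_imp_le)

lemma cdb_B_holomorphic: "cdb_B t \<mu> A \<gamma> holomorphic_on UNIV"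
  unfolding cdb_B_eq by (intro holomorphic_intros A kernel_sum_holomorphic[OF \<mu>_conv'])

text \<open>At a zero of \<open>A\<close> the term with \<gamma> disappears and only
  \<open>- \<mu> m * deriv A (t m)\<close> is left. This supplies the centre for Jensen's
  inequality, whatever \<gamma> is, and later a nonzero value of the exceptional element.\<close>

lemma cdb_B_at_node: "cdb_B t \<mu> A \<gamma> (t m) \<noteq> 0"
proof -
  have "A (t m) = 0" using zeros by blast
  then show ?thesis
    using deriv_A[of m] \<mu>_pos[of m] kernel_sum_at_node[of "\<lambda>n. of_real (\<mu> n)" m] by (simp add: cdb_B_eq)
qed

lemma cdb_B_exp_growth:
  assumes "k \<ge> 1" "exp_growth k A"
  shows "exp_growth k (cdb_B t \<mu> A \<gamma>)"
  unfolding cdb_B_eq by (intro exp_growth_diff exp_growth_cmult kernel_sum_exp_growth[OF \<mu>_conv'] assms)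

lemma cdb_spaceE:
  assumes "F \<in> cdb_space t \<mu> A"
  obtains c d where "F = (\<lambda>z. \<Sum>n. d n * cdb_kernel A t n z)"
    "summable (\<lambda>n. norm (d n) / (1 + norm (t n)))"
    "d = (\<lambda>n. c n * of_real (sqrt (\<mu> n)))" "summable (\<lambda>n. (norm (c n))\<^sup>2)"
proof -
  obtain c where c: "summable (\<lambda>n. (norm (c n))\<^sup>2)"
    "F = (\<lambda>z. \<Sum>n. c n * of_real (sqrt (\<mu> n)) * cdb_kernel A t n z)"
    using assms unfolding cdb_space_def by blast
  have "summable (\<lambda>n. \<mu> n * (1 / (1 + norm (t n)))\<^sup>2)"
  proof (rule summable_comparison_test[OF _ \<mu>_sum], intro exI allI impI)
    fix n
    have "(norm (t n))\<^sup>2 + 1 \<le> (1 + norm (t n))\<^sup>2" by (simp add: power2_sum)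
    moreover have "(norm (t n))\<^sup>2 + 1 > 0" by (simp add: add_nonneg_pos)
    ultimately have "\<mu> n / (1 + norm (t n))\<^sup>2 \<le> \<mu> n / ((norm (t n))\<^sup>2 + 1)"
      using less_imp_le[OF \<mu>_pos] by (intro frac_le) auto
    then show "norm (\<mu> n * (1 / (1 + norm (t n)))\<^sup>2) \<le> \<mu> n / ((norm (t n))\<^sup>2 + 1)"
      using \<mu>_pos[of n] by (simp add: power_divide)
  qed
  from summable_cmod_mult_sqrt[OF c(1) less_imp_le[OF \<mu>_pos] _ this]
  have "summable (\<lambda>n. norm (c n * of_real (sqrt (\<mu> n))) / (1 + norm (t n)))" by simp
  then show ?thesis using that[OF _ _ refl c(1)] c(2) by blast
qed

lemma uniqueness_cdb_B:
  assumes \<gamma>: "\<gamma> \<noteq> 0"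
  shows "uniqueness_set_of (cdb_space t \<mu> A) (cdb_B t \<mu> A \<gamma>)"
  unfolding uniqueness_set_of_def
proof (intro ballI impI)
  fix F assume FS: "F \<in> cdb_space t \<mu> A" and van: "vanishes_on_zeros F (cdb_B t \<mu> A \<gamma>)"
  obtain c d where F: "F = (\<lambda>z. \<Sum>n. d n * cdb_kernel A t n z)"
    and d: "summable (\<lambda>n. norm (d n) / (1 + norm (t n)))"
    and "d = (\<lambda>n. c n * of_real (sqrt (\<mu> n)))" "summable (\<lambda>n. (norm (c n))\<^sup>2)"
    by (rule cdb_spaceE[OF FS])
  obtain k where k: "k \<ge> 1" "exp_growth k A" by (rule finite_order_imp_exp_growth[OF A ford])
  let ?B = "cdb_B t \<mu> A \<gamma>"
  obtain S where S: "S holomorphic_on UNIV" "\<And>z. S z * ?B z = F z"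
    by (rule entire_quotient_exists[OF _ cdb_B_holomorphic cdb_B_at_node van])
       (use kernel_sum_holomorphic[OF d] F in auto)
  \<comment> \<open>A single weight dominating the coefficients of both F and B, so that one
    potential controls both.\<close>
  define w where "w = (\<lambda>n. \<mu> n + norm (d n))"
  have w: "w n > 0" "norm (d n) \<le> w n" "norm (complex_of_real (\<mu> n)) \<le> w n" for n
    using \<mu>_pos[of n] by (auto simp: w_def intro: add_pos_nonneg)
  have "S z = 0" for z
  proof (rule entire_quotient_small_off_potential_eq_0[OF S(1) cdb_B_holomorphic S(2) cdb_B_at_node])
    show "exp_growth k F" unfolding F by (rule kernel_sum_exp_growth[OF d k])
    show "exp_growth k ?B" by (rule cdb_B_exp_growth[OF k])
    show "summable (\<lambda>n. w n / (1 + norm (t n)))"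
      using summable_add[OF \<mu>_conv d] by (simp add: w_def add_divide_distrib)
    show "w n \<ge> 0" for n using w(1)[of n] by simp
    fix \<eta> :: real assume \<eta>: "\<eta> > 0"
    \<comment> \<open>The bound |\<gamma>| / 2 leaves |B| \<ge> (|\<gamma>| / 2) |A| after
      subtracting the series; the bound with \<eta> makes |F| at most \<eta> times that lower
      bound.\<close>
    define \<kappa> where "\<kappa> = norm \<gamma> / 2 * min 1 \<eta>"
    have \<kappa>: "\<kappa> > 0" "\<kappa> \<le> norm \<gamma> / 2" "\<kappa> \<le> norm \<gamma> / 2 * \<eta>"
      using \<gamma> \<eta> mult_left_mono[of "min 1 \<eta>" 1 "norm \<gamma> / 2"] mult_left_mono[of "min 1 \<eta>" \<eta> "norm \<gamma> / 2"]
      by (auto simp: \<kappa>_def)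
    have "norm (S z) \<le> \<eta>" if pot: "cauchy_potential w t z < ennreal \<kappa>" for z
    proof -
      note dF = kernel_sum_le_potential[OF d w(1,2) pot]
      note dB = kernel_sum_le_potential[OF \<mu>_conv' w(1,3) pot]
      have "norm (\<gamma> * A z) \<le> norm (?B z) + norm (\<Sum>n. of_real (\<mu> n) * cdb_kernel A t n z)"
        using norm_triangle_ineq[of "?B z" "\<Sum>n. of_real (\<mu> n) * cdb_kernel A t n z"] by (simp add: cdb_B_eq)
      then have B: "norm \<gamma> / 2 * norm (A z) \<le> norm (?B z)"
        using dB(2) mult_right_mono[OF \<kappa>(2), of "norm (A z)"] by (simp add: norm_mult)
      have "norm (S z) * (norm \<gamma> / 2 * norm (A z)) \<le> norm (S z) * norm (?B z)"
        by (rule mult_left_mono[OF B]) simp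
      also have "\<dots> = norm (F z)" using S(2)[of z] by (simp add: norm_mult[symmetric])
      also have "\<dots> \<le> \<kappa> * norm (A z)" using dF(2) by (simp add: F)
      also have "\<dots> \<le> norm \<gamma> / 2 * \<eta> * norm (A z)" by (rule mult_right_mono[OF \<kappa>(3)]) simp
      also have "\<dots> = \<eta> * (norm \<gamma> / 2 * norm (A z))" by simp
      finally show ?thesis by (rule mult_right_le_imp_le) (use dF(1) \<gamma> in auto)
    qed
    then show "\<exists>\<kappa>>0. \<forall>z. cauchy_potential w t z < ennreal \<kappa> \<longrightarrow> norm (S z) \<le> \<eta>"
      using \<kappa>(1) by blast
  qed
  then show "F = (\<lambda>z. 0)" using S(2) by (metis mult_zero_left ext)
qed

lemma cdb_B_0_multiple:
  assumes sm: "summable \<mu>" and F: "F \<in> cdb_space t \<mu> A" and van: "vanishes_on_zeros F (cdb_B t \<mu> A 0)"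
  shows "\<exists>a. \<forall>z. F z = a * cdb_B t \<mu> A 0 z"
proof -
  obtain c d where Fd: "F = (\<lambda>z. \<Sum>n. d n * cdb_kernel A t n z)"
    and d: "summable (\<lambda>n. norm (d n) / (1 + norm (t n)))"
    and dc: "d = (\<lambda>n. c n * of_real (sqrt (\<mu> n)))" and c: "summable (\<lambda>n. (norm (c n))\<^sup>2)"
    by (rule cdb_spaceE[OF F])
  have d1: "summable (\<lambda>n. norm (d n))"
    using summable_cmod_mult_sqrt[OF c less_imp_le[OF \<mu>_pos], of "\<lambda>_. 1"] sm by (simp add: dc)
  obtain k where k: "k \<ge> 1" "exp_growth k A" by (rule finite_order_imp_exp_growth[OF A ford])
  let ?B = "cdb_B t \<mu> A 0"
  have B: "?B z = - (\<Sum>n. of_real (\<mu> n) * cdb_kernel A t n z)" for z by (simp add: cdb_B_eq)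
  obtain S where S: "S holomorphic_on UNIV" "\<And>z. S z * ?B z = F z"
    by (rule entire_quotient_exists[OF _ cdb_B_holomorphic cdb_B_at_node van])
       (use kernel_sum_holomorphic[OF d] Fd in auto)
  have \<mu>1: "summable (\<lambda>n. norm (complex_of_real (\<mu> n)))" using sm \<mu>_pos by (simp add: less_imp_le)
  define m where "m = (\<Sum>n. \<mu> n)"
  have m: "m > 0" unfolding m_def by (rule suminf_pos[OF sm \<mu>_pos])
  \<comment> \<open>At infinity, off the bad set, z F / A behaves like the sum of the
    \<open>d n\<close> and z B / A like \<open>- m\<close>, so the ratio of the two is the only
    possible value of S. With it the coefficients \<open>e\<close> of F - a B have sum 0, and the
    leading term of z (F - a B) / A cancels.\<close>
  define a where "a = - (\<Sum>n. d n) / of_real m"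
  define e where "e = (\<lambda>n. d n + a * of_real (\<mu> n))"
  have am1: "summable (\<lambda>n. norm (a * of_real (\<mu> n)))"
    unfolding norm_mult[of a] by (rule summable_mult[OF \<mu>1])
  have e1: "summable (\<lambda>n. norm (e n))"
    by (rule summable_comparison_test[OF _ summable_add[OF d1 am1]])
       (auto simp: e_def intro: norm_triangle_ineq)
  have weaken: "summable (\<lambda>n. norm (x n) / (1 + norm (t n)))" if "summable (\<lambda>n. norm (x n))" for x :: "nat \<Rightarrow> complex"
    by (rule summable_comparison_test[OF _ that])
       (auto simp: divide_le_eq add_pos_nonneg mult_le_cancel_left1)
  have esum: "(\<Sum>n. e n) = 0"
  proof -
    have "(\<Sum>n. complex_of_real (\<mu> n)) = of_real m"
      unfolding m_def by (rule suminf_of_real[OF sm, symmetric])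
    then have "(\<Sum>n. e n) = (\<Sum>n. d n) + a * of_real m"
      unfolding e_def
      using suminf_add[OF summable_norm_cancel[OF d1] summable_norm_cancel[OF am1]]
        suminf_mult[OF summable_norm_cancel[OF \<mu>1], of a] by simp
    then show ?thesis using m by (simp add: a_def)
  qed
  have eF: "F z - a * ?B z = (\<Sum>n. e n * cdb_kernel A t n z)" for z
  proof -
    have "(\<Sum>n. e n * cdb_kernel A t n z) = (\<Sum>n. d n * cdb_kernel A t n z + a * (of_real (\<mu> n) * cdb_kernel A t n z))"
      by (simp add: e_def distrib_right mult.assoc)
    also have "\<dots> = F z + a * (\<Sum>n. of_real (\<mu> n) * cdb_kernel A t n z)"
      using suminf_add[OF kernel_sum_summable[OF d, of z] summable_mult[OF kernel_sum_summable[OF \<mu>_conv', of z], of a]]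
        suminf_mult[OF kernel_sum_summable[OF \<mu>_conv', of z], of a] by (simp add: Fd)
    finally show ?thesis by (simp add: B)
  qed
  \<comment> \<open>Multiplication by z turns the coefficients \<open>e n\<close> and
    \<open>\<mu> n\<close> into \<open>e n * t n\<close> and \<open>\<mu> n * t n\<close>, hence the
    factor \<open>1 + norm (t n)\<close>. The weight is still admissible because \<mu> and
    \<open>e\<close> are summable.\<close>
  define w where "w = (\<lambda>n. (\<mu> n + norm (e n)) * (1 + norm (t n)))"
  have w: "w n > 0" "norm (e n * t n) \<le> w n" "norm (complex_of_real (\<mu> n) * t n) \<le> w n" for n
    using \<mu>_pos[of n] unfolding w_def norm_mult
    by (auto intro!: mult_pos_pos mult_mono add_pos_nonneg)
  have wt: "summable (\<lambda>n. norm (x n * t n) / (1 + norm (t n)))" if "summable (\<lambda>n. norm (x n))" for x :: "nat \<Rightarrow> complex"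
    by (rule summable_comparison_test[OF _ that])
       (auto simp: norm_mult divide_le_eq add_pos_nonneg mult_left_mono)
  have "S z - a = 0" for z
  proof (rule entire_quotient_small_off_potential_eq_0[where S = "\<lambda>z. S z - a" and F = "\<lambda>z. F z - a * ?B z" and B = ?B and k = k and w = w and t = t])
    show "(\<lambda>z. S z - a) holomorphic_on UNIV" by (intro holomorphic_intros S)
    show "(S z - a) * ?B z = F z - a * ?B z" for z by (simp add: left_diff_distrib S(2))
    show "exp_growth k (\<lambda>z. F z - a * ?B z)"
      unfolding eF by (rule kernel_sum_exp_growth[OF weaken[OF e1] k])
    show "exp_growth k ?B" by (rule cdb_B_exp_growth[OF k])
    have "w n / (1 + norm (t n)) = \<mu> n + norm (e n)" for n
      using add_pos_nonneg[OF zero_less_one norm_ge_zero, of "t n"] by (simp add: w_def)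
    then show "summable (\<lambda>n. w n / (1 + norm (t n)))"
      using summable_add[OF sm e1] by simp
    show "w n \<ge> 0" for n using w(1)[of n] by simp
    fix \<eta> :: real assume \<eta>: "\<eta> > 0"
    \<comment> \<open>The total mass m, the modulus of the leading coefficient of z B / A, now plays
      the part of |\<gamma>|.\<close>
    define \<kappa> where "\<kappa> = m / 2 * min 1 \<eta>"
    have \<kappa>: "\<kappa> > 0" "\<kappa> \<le> m / 2" "\<kappa> \<le> m / 2 * \<eta>"
      using m \<eta> mult_left_mono[of "min 1 \<eta>" 1 "m / 2"] mult_left_mono[of "min 1 \<eta>" \<eta> "m / 2"]
      by (auto simp: \<kappa>_def)
    have "norm (S z - a) \<le> \<eta>" if pot: "cauchy_potential w t z < ennreal \<kappa>" for z
    proof -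
      note dF = kernel_sum_le_potential[OF wt[OF e1] w(1,2) pot]
      note dB = kernel_sum_le_potential[OF wt[OF \<mu>1] w(1,3) pot]
      have zF: "z * (F z - a * ?B z) = (\<Sum>n. e n * t n * cdb_kernel A t n z)"
        unfolding eF kernel_sum_mult[OF e1] esum by simp
      have "z * ?B z = - (A z * of_real m + (\<Sum>n. of_real (\<mu> n) * t n * cdb_kernel A t n z))"
        unfolding B mult_minus_right kernel_sum_mult[OF \<mu>1] m_def suminf_of_real[OF sm] ..
      then have "A z * of_real m = - (z * ?B z) - (\<Sum>n. of_real (\<mu> n) * t n * cdb_kernel A t n z)" by simp
      then have "norm (A z * of_real m) \<le> norm (z * ?B z) + norm (\<Sum>n. of_real (\<mu> n) * t n * cdb_kernel A t n z)"
        using norm_triangle_ineq4[of "- (z * ?B z)" "\<Sum>n. of_real (\<mu> n) * t n * cdb_kernel A t n z"] by simp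
      then have B: "m / 2 * norm (A z) \<le> norm (z * ?B z)"
        using dB(2) mult_right_mono[OF \<kappa>(2), of "norm (A z)"] m by (simp add: norm_mult mult.commute)
      \<comment> \<open>Both F - a B and B carry the factor z, which is never divided out, so z = 0
        needs no separate case.\<close>
      have "norm (S z - a) * (m / 2 * norm (A z)) \<le> norm (S z - a) * norm (z * ?B z)"
        by (rule mult_left_mono[OF B]) simp
      also have "\<dots> = norm (z * (F z - a * ?B z))"
        unfolding S(2)[symmetric] left_diff_distrib[symmetric] norm_mult by simp
      also have "\<dots> \<le> \<kappa> * norm (A z)" unfolding zF by (rule dF(2))
      also have "\<dots> \<le> m / 2 * \<eta> * norm (A z)" by (rule mult_right_mono[OF \<kappa>(3)]) simp
      also have "\<dots> = \<eta> * (m / 2 * norm (A z))" by simp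
      finally show ?thesis by (rule mult_right_le_imp_le) (use dF(1) m in auto)
    qed
    then show "\<exists>\<kappa>>0. \<forall>z. cauchy_potential w t z < ennreal \<kappa> \<longrightarrow> norm (S z - a) \<le> \<eta>"
      using \<kappa>(1) by blast
  qed (rule cdb_B_holomorphic cdb_B_at_node)+
  then have "S z = a" for z by simp
  then show ?thesis using S(2) by metis
qed

text \<open>The coefficients are \<open>c n = sqrt (\<mu> n)\<close>, and their square summability
  is exactly the summability of \<mu>.\<close>

lemma cdb_B_0_in_space:
  assumes "summable \<mu>"
  shows "(\<lambda>z. - cdb_B t \<mu> A 0 z) \<in> cdb_space t \<mu> A"
  unfolding cdb_space_def
proof (intro CollectI exI conjI)
  show "summable (\<lambda>n. (norm (complex_of_real (sqrt (\<mu> n))))\<^sup>2)"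
    using assms \<mu>_pos by (simp add: less_imp_le)
  have "complex_of_real (sqrt (\<mu> n)) * of_real (sqrt (\<mu> n)) = of_real (\<mu> n)" for n
    using \<mu>_pos[of n] by (simp flip: of_real_mult)
  then show "(\<lambda>z. - cdb_B t \<mu> A 0 z)
      = (\<lambda>z. \<Sum>n. complex_of_real (sqrt (\<mu> n)) * of_real (sqrt (\<mu> n)) * cdb_kernel A t n z)"
    by (simp add: cdb_B_eq)
qed

end

theorem theorem1p5:
  fixes t :: "nat \<Rightarrow> complex" and \<mu> :: "nat \<Rightarrow> real" and A :: "complex \<Rightarrow> complex"
  assumes data: "cdb_data t \<mu> A"
    and conv: "convergence_class t \<mu>"
    and ford: "finite_order A"
  shows "(\<forall>\<gamma>::complex. \<gamma> \<noteq> 0 \<longrightarrow> uniqueness_set_of (cdb_space t \<mu> A) (cdb_B t \<mu> A \<gamma>))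
       \<and> (small_space \<mu> \<longrightarrow>
           \<not> uniqueness_set_of (cdb_space t \<mu> A) (cdb_B t \<mu> A 0) \<and>
           (\<exists>G\<in>cdb_space t \<mu> A. vanishes_on_zeros G (cdb_B t \<mu> A 0) \<and> G \<noteq> (\<lambda>z. 0) \<and>
              (\<forall>F\<in>cdb_space t \<mu> A. vanishes_on_zeros F (cdb_B t \<mu> A 0) \<longrightarrow>
                 (\<exists>a::complex. F = (\<lambda>z. a * G z)))))"
proof -
  interpret cdb_measure t A \<mu>
    using data conv ford
    by unfold_locales (auto simp: cdb_data_def convergence_class_def add.commute)
  have small: "\<not> uniqueness_set_of (cdb_space t \<mu> A) (cdb_B t \<mu> A 0) \<and>
           (\<exists>G\<in>cdb_space t \<mu> A. vanishes_on_zeros G (cdb_B t \<mu> A 0) \<and> G \<noteq> (\<lambda>z. 0) \<and>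
              (\<forall>F\<in>cdb_space t \<mu> A. vanishes_on_zeros F (cdb_B t \<mu> A 0) \<longrightarrow>
                 (\<exists>a::complex. F = (\<lambda>z. a * G z))))" if "small_space \<mu>"
  proof -
    have sm: "summable \<mu>" using that by (simp add: small_space_def)
    define G where "G = (\<lambda>z. - cdb_B t \<mu> A 0 z)"
    have G: "G \<in> cdb_space t \<mu> A" unfolding G_def by (rule cdb_B_0_in_space[OF sm])
    have "G holomorphic_on UNIV" unfolding G_def by (intro holomorphic_intros cdb_B_holomorphic)
    then have "vanishes_on_zeros G (\<lambda>z. - G z)" by (rule vanishes_on_zeros_uminus)
    then have van: "vanishes_on_zeros G (cdb_B t \<mu> A 0)" by (simp add: G_def)
    have "G (t 0) \<noteq> 0" using cdb_B_at_node by (simp add: G_def)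
    then have G0: "G \<noteq> (\<lambda>z. 0)" by auto
    have "\<exists>a. F = (\<lambda>z. a * G z)" if F: "F \<in> cdb_space t \<mu> A" "vanishes_on_zeros F (cdb_B t \<mu> A 0)" for F
    proof -
      obtain a where "\<And>z. F z = a * cdb_B t \<mu> A 0 z" using cdb_B_0_multiple[OF sm F] by blast
      then show ?thesis by (intro exI[of _ "- a"]) (simp add: G_def fun_eq_iff)
    qed
    then show ?thesis using G van G0 unfolding uniqueness_set_of_def by blast
  qed
  show ?thesis using uniqueness_cdb_B small by blast
qed

end
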